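(* Let $p\in\tfrac12\mathbb Z_{\ge0}$ and let $$\chi(z)=\sum_{k=-2p}^{\infty}\chi_{-\frac k2}z^{\frac k2-1}\in\mathbb C((z^{1/2})).$$ Let $i\in\{1,2\}$. Then $F^{T_i}(\chi)$ is an irreducible $\mathcal A^{tw}$-module if and only if one of the following conditions holds: (i) $p>0$ and $\chi_p\ne0$; (ii) $p=0$ and $\chi_0\in(\mathbb C\setminus\tfrac12\mathbb Z)\cup\{\tfrac12\}$; (iii) $p=0$, $\chi_0-\tfrac12=\ell\in\tfrac12\mathbb Z_{\ge0}$, and $\det A(\chi)\ne0$, where $A(\chi)$ is the $2\ell\times2\ell$ matrix $$A(\chi)=\begin{pmatrix}2S(-1)&2S(-2)&\cdots&&2S(-2\ell)\\ \ell^2-(\ell-1)^2&2S(-1)&2S(-2)&\cdots&2S(-2\ell+1)\\ 0&\ell^2-(\ell-2)^2&2S(-1)&\cdots&2S(-2\ell+2)\\ \vdots&\ddots&\ddots&\ddots&\vdots\\ 0&\cdots&0&\ell^2-(\ell-2\ell+1)^2&2S(-1)\end{pmatrix}$$ (entry $2S(-(b-a+1))$ in position $(a,b)$ for $b\ge a$, entry $\ell^2-(\ell-a)^2$ in position $(a+1,a)$, and $0$ otherwise), with $$S(z)=\tfrac12\big(\chi^{(1)}(z)^2+\partial_z\chi^{(1)}(z)\big)=\sum_{n\in\mathbb Z}S(n)z^{-n-2},$$ and $\chi^{(1)}(z)$ is the integral part of $\chi(z)$, i.e. the sum of the terms with integer powers of $z$.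
   Context: **The Lie superalgebra $\mathcal A^{tw}$.** It has basis $\mathcal S(n),\mathcal T(n+\tfrac12),\mathcal G(r),C$ ($n\in\mathbb Z$, $r\in\tfrac12\mathbb Z$), with $\mathcal S(n),\mathcal T(n+\frac12),C$ even and central, $\mathcal G(r)$ odd, and $$\{\mathcal G(r),\mathcal G(s)\}=(-1)^{2r+1}\Big(2\delta^{\mathbb Z}_{r+s}\mathcal S(r+s)-\delta^{\frac12+\mathbb Z}_{r+s}(r-s)\mathcal T(r+s)+\tfrac C3\delta^{\mathbb Z}_{r+s}(r^2-\tfrac14)\delta_{r+s,0}\Big),$$ where $\delta_m^X=1$ if $m\in X$, $0$ otherwise. **The modules $F^{T_i}(\chi)$.** Let $CL^{tw}$ be the associative algebra generated by $\Phi(r)$, $r\in\tfrac12\mathbb Z$, with $\{\Phi(r),\Phi(s)\}=-(-1)^{2r}\delta_{r+s,0}$. For $i=1,2$ let $F^{T_i}$ be the irreducible $CL^{tw}$-module generated by a vector $\mathbf 1$ with $\Phi(r)\mathbf 1=0$ for $r>0$ and $\Phi(0)\mathbf 1=(-1)^i\frac1{\sqrt{-2}}\mathbf 1$; as a vector space $F^{T_i}=\bigwedge(\Phi(r)\mid r\in\frac12\mathbb Z,\ r<0)$. Put $\Phi(z)=\sum_{r\in\frac12\mathbb Z}\Phi(r)z^{-r-1/2}$. For $\chi(z)=\sum_{n\in\frac12\mathbb Z}\chi_nz^{-n-1}\in\mathbb C((z^{1/2}))$, $F^{T_i}(\chi)$ is the space $F^{T_i}$ with the $\mathcal A^{tw}$-action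 (with $C=-3$, and $\mathcal S(n),\mathcal T(n+\frac12)$ acting by scalars) given by $$\sum_{r\in\frac12\mathbb Z}\mathcal G(r)z^{-r-3/2}=\partial_z\Phi(z)+\chi(z)\Phi(z),\quad\text{i.e. } \mathcal G(r)=-(r+\tfrac12)\Phi(r)+\sum_{k\in\frac12\mathbb Z}\chi_k\Phi(r-k).$$ Irreducible means no proper nonzero invariant subspace (modules need not be $\mathbb Z_2$-graded).
   Formalization: The expansion of χ is assumed to start exactly at k = −2p: if p > 0 then χ_p ≠ 0. Without this the equivalence fails (p = 1, χ_1 = χ_{1/2} = 0, χ_0 = 1/3: irreducible, but (i)–(iii) all fail). Every χ has an admissible p. *)

theory Defs
  imports
    Complex_Main
    "HOL-Library.Poly_Mapping"
    "HOL-Computational_Algebra.Formal_Laurent_Series"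
    "Jordan_Normal_Form.Determinant"
begin

text \<open>
  Half-integers are encoded by their doubles throughout: the integer \<open>h\<close> stands for \<open>h / 2\<close>.
  A complex vector space is a type of class \<open>ab_group_add\<close> with an explicit scalar multiplication.
\<close>

subsection \<open>Invariant subspaces\<close>

definition irreducible_action ::
    "(complex \<Rightarrow> 'v \<Rightarrow> 'v) \<Rightarrow> ('x \<Rightarrow> 'v \<Rightarrow> 'v::ab_group_add) \<Rightarrow> bool" where
  "irreducible_action smul \<rho> \<longleftrightarrow>
     (\<exists>v::'v. v \<noteq> 0) \<and>
     (\<forall>U. Modules.module.subspace smul U \<and> (\<forall>x. \<forall>u\<in>U. \<rho> x u \<in> U) \<longrightarrow> U = {0} \<or> U = UNIV)"


subsection \<open>The Lie superalgebra\<close>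

text \<open>\<open>SS n\<close> is \<open>S(n)\<close>, \<open>TT n\<close> is \<open>T(n + 1/2)\<close> and \<open>GG h\<close> is \<open>G(h/2)\<close>.\<close>

datatype Atw_basis = SS int | TT int | GG int | CC

fun Atw_odd :: "Atw_basis \<Rightarrow> bool" where
  "Atw_odd (GG _) = True"
| "Atw_odd _ = False"

text \<open>
  The superbracket of two basis vectors, as a formal linear combination of basis vectors. For
  \<open>r = h/2\<close> and \<open>s = k/2\<close> one has \<open>r + s \<in> \<int>\<close> iff \<open>h + k\<close> is even; otherwise
  \<open>r + s = (h + k - 1)/2 + 1/2\<close>.
\<close>

fun Atw_bracket :: "Atw_basis \<Rightarrow> Atw_basis \<Rightarrow> Atw_basis \<Rightarrow>\<^sub>0 complex" where
  "Atw_bracket (GG h) (GG k) =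
     (let r = of_int h / 2; s = of_int k / 2; e = (-1) powi (h + 1) in
      if even (h + k)
      then Poly_Mapping.single (SS ((h + k) div 2)) (e * 2)
           + Poly_Mapping.single CC (e * (1/3) * (r\<^sup>2 - 1/4) * (if h + k = 0 then 1 else 0))
      else Poly_Mapping.single (TT ((h + k - 1) div 2)) (e * - (r - s)))"
| "Atw_bracket _ _ = 0"

definition Atw_module ::
    "(complex \<Rightarrow> 'v \<Rightarrow> 'v) \<Rightarrow> (Atw_basis \<Rightarrow> 'v \<Rightarrow> 'v::ab_group_add) \<Rightarrow> bool" where
  "Atw_module smul \<rho> \<longleftrightarrow>
     vector_space smul \<and>
     (\<forall>x. Vector_Spaces.linear smul smul (\<rho> x)) \<and>
     (\<forall>x y v. (if Atw_odd x \<and> Atw_odd y then \<rho> x (\<rho> y v) + \<rho> y (\<rho> x v)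
                else \<rho> x (\<rho> y v) - \<rho> y (\<rho> x v)) =
        (\<Sum>z\<in>Poly_Mapping.keys (Atw_bracket x y).
           smul (Poly_Mapping.lookup (Atw_bracket x y) z) (\<rho> z v)))"

definition irreducible_Atw_module ::
    "(complex \<Rightarrow> 'v \<Rightarrow> 'v) \<Rightarrow> (Atw_basis \<Rightarrow> 'v \<Rightarrow> 'v::ab_group_add) \<Rightarrow> bool" where
  "irreducible_Atw_module smul \<rho> \<longleftrightarrow> Atw_module smul \<rho> \<and> irreducible_action smul \<rho>"


subsection \<open>The twisted Clifford algebra and its modules\<close>

text \<open>\<open>\<Phi> h\<close> is the operator \<open>\<Phi>(h/2)\<close>.\<close>

definition CLtw_module ::
    "(complex \<Rightarrow> 'v \<Rightarrow> 'v) \<Rightarrow> (int \<Rightarrow> 'v \<Rightarrow> 'v::ab_group_add) \<Rightarrow> bool" where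
  "CLtw_module smul \<Phi> \<longleftrightarrow>
     vector_space smul \<and>
     (\<forall>h. Vector_Spaces.linear smul smul (\<Phi> h)) \<and>
     (\<forall>h k v. \<Phi> h (\<Phi> k v) + \<Phi> k (\<Phi> h v) =
        smul (- ((-1) powi h) * (if h + k = 0 then 1 else 0)) v)"

definition is_F_T ::
    "nat \<Rightarrow> (complex \<Rightarrow> 'v \<Rightarrow> 'v) \<Rightarrow> (int \<Rightarrow> 'v \<Rightarrow> 'v::ab_group_add) \<Rightarrow> 'v \<Rightarrow> bool" where
  "is_F_T i smul \<Phi> vac \<longleftrightarrow>
     CLtw_module smul \<Phi> \<and> irreducible_action smul \<Phi> \<and>
     (\<forall>U. Modules.module.subspace smul U \<and> (\<forall>h. \<forall>u\<in>U. \<Phi> h u \<in> U) \<and> vac \<in> U \<longrightarrow> U = UNIV) \<and>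
     (\<forall>h>0. \<Phi> h vac = 0) \<and>
     \<Phi> 0 vac = smul ((-1) ^ i * (1 / csqrt (-2))) vac"


subsection \<open>The modules attached to a Laurent series\<close>

text \<open>
  An element \<open>\<chi>\<close> of \<open>\<complex>((z\<^bsup>1/2\<^esup>))\<close> is a formal Laurent series in the variable \<open>X = z\<^bsup>1/2\<^esup>\<close>.
  The coefficient \<open>\<chi>\<^sub>n\<close>, \<open>n = h/2\<close>, belongs to \<open>z\<^bsup>-n-1\<^esup> = X\<^bsup>-h-2\<^esup>\<close>.
\<close>

definition chi_coeff :: "complex fls \<Rightarrow> int \<Rightarrow> complex" where
  "chi_coeff chi h = fls_nth chi (- h - 2)"

text \<open>
  The scalars by which \<open>S(n)\<close> and \<open>T(n + 1/2)\<close> act are the ones forced by the relations of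
  the algebra: \<open>T(n + 1/2)\<close> acts as \<open>\<chi>\<^bsub>n+1/2\<^esub>\<close>, and \<open>S(n)\<close> as the coefficient of \<open>z\<^bsup>-n-2\<^esup>\<close> in
  \<open>1/2 ((\<chi>\<^bsup>(1)\<^esup>)\<^sup>2 - (\<chi>\<^bsup>(2)\<^esup>)\<^sup>2 + \<partial>\<chi>\<^bsup>(1)\<^esup>)\<close>, where \<open>\<chi>\<^bsup>(1)\<^esup>\<close> and \<open>\<chi>\<^bsup>(2)\<^esup>\<close> are the parts of \<open>\<chi>\<close> with
  integral and with non-integral powers of \<open>z\<close>. They are not the numbers \<open>S(n)\<close>
  entering \<open>A(\<chi>)\<close> below, where \<open>\<chi>\<^bsup>(2)\<^esup>\<close> does not occur. All sums have finite support.
\<close>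

fun F_chi :: "(complex \<Rightarrow> 'v \<Rightarrow> 'v) \<Rightarrow> (int \<Rightarrow> 'v \<Rightarrow> 'v) \<Rightarrow> complex fls
    \<Rightarrow> Atw_basis \<Rightarrow> 'v \<Rightarrow> 'v::ab_group_add" where
  "F_chi smul \<Phi> chi (GG h) v =
     smul (- (of_int h / 2 + 1/2)) (\<Phi> h v)
     + Sum_any (\<lambda>k. smul (chi_coeff chi k) (\<Phi> (h - k) v))"
| "F_chi smul \<Phi> chi (SS n) v =
     smul (1/2 * (Sum_any (\<lambda>k. (-1) powi k * chi_coeff chi k * chi_coeff chi (2 * n - k))
                   - (of_int n + 1) * chi_coeff chi (2 * n))) v"
| "F_chi smul \<Phi> chi (TT n) v = smul (chi_coeff chi (2 * n + 1)) v"
| "F_chi smul \<Phi> chi CC v = smul (-3) v"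


subsection \<open>The matrix\<close>

text \<open>\<open>\<chi>\<^bsup>(1)\<^esup>\<close> and \<open>S\<close> are Laurent series in \<open>z\<close> itself; \<open>z\<^bsup>m\<^esup> = X\<^bsup>2m\<^esup>\<close>.\<close>

definition integral_part :: "complex fls \<Rightarrow> complex fls" where
  "integral_part chi = Abs_fls (\<lambda>m. fls_nth chi (2 * m))"

definition S_series :: "complex fls \<Rightarrow> complex fls" where
  "S_series chi = fls_const (1/2) * ((integral_part chi)\<^sup>2 + fls_deriv (integral_part chi))"

definition S_coeff :: "complex fls \<Rightarrow> int \<Rightarrow> complex" where
  "S_coeff chi n = fls_nth (S_series chi) (- n - 2)"

lemma fls_nth_integral_part: "fls_nth (integral_part chi) m = fls_nth chi (2 * m)"
proof -
  have "fls_nth chi (2 * m) = 0" if "m < - \<bar>fls_subdegree chi\<bar>" for m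
    using that by (intro fls_eq0_below_subdegree) linarith
  then show ?thesis
    unfolding integral_part_def by (intro nth_Abs_fls_lower_bound) blast
qed

text \<open>
  \<open>A(\<chi>)\<close> for \<open>\<ell> = l = L/2\<close>. Library matrices are indexed from 0, so the index pair \<open>(i, j)\<close> is the
  position \<open>(a, b) = (i + 1, j + 1)\<close>.
\<close>

definition A_matrix :: "complex fls \<Rightarrow> nat \<Rightarrow> complex mat" where
  "A_matrix chi L = mat L L (\<lambda>(i, j).
     let a = i + 1; b = j + 1; l = of_nat L / 2 in
     if b \<ge> a then 2 * S_coeff chi (- (int b - int a + 1))
     else if a = b + 1 then l\<^sup>2 - (l - of_nat b)\<^sup>2
     else 0)"

end

theory Submission
  imports Defs
begin

text \<open>
  On a vector killed by all large modes, \<open>G(r)\<close> is an infinite combination of the \<open>\<Phi>(s)\<close>, \<open>s \<ge> r - p\<close>,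
  whose leading coefficient is \<open>\<chi>\<^sub>p\<close> if \<open>p > 0\<close> and \<open>\<chi>\<^sub>0 - 1/2 - r\<close> if \<open>p = 0\<close>. If these leading
  coefficients never vanish, a downward elimination recovers every \<open>\<Phi>(s)\<close> from the \<open>G(r)\<close>, so that an
  invariant subspace for the \<open>G(r)\<close> is invariant for the Clifford algebra.

  Otherwise \<open>p = 0\<close> and \<open>\<chi>\<^sub>0 - 1/2 = \<ell>\<close> is a half-integer, and up to a factor there is exactly one infinite
  combination \<open>X\<close> of the \<open>\<Phi>(s)\<close>, \<open>s \<ge> -\<ell>\<close>, that anticommutes with all \<open>G(r)\<close>. Its square is a scalar.
  If \<open>X\<^sup>2 = 0\<close>, the kernel of \<open>X\<close> is a proper invariant subspace. If \<open>X\<^sup>2 = \<kappa> \<noteq> 0\<close>, an invariant subspace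
  \<open>U\<close> that is neither zero nor everything would satisfy \<open>V = U \<oplus> X U\<close>; then \<open>u + X w \<mapsto> X u - \<kappa> w\<close>
  anticommutes with all \<open>\<Phi>(s)\<close> and sends the vacuum to a vacuum with the opposite
  eigenvalue of \<open>\<Phi>(0)\<close>, which does not exist.

  The coefficients of \<open>X\<close> solve a first order differential equation, and \<open>X\<^sup>2\<close> is, up to a nonzero factor, the
  coefficient of \<open>z\<^bsup>2\<ell>\<^esup>\<close> in \<open>f\<^sup>2\<close>, where \<open>z f' = -(z \<chi>\<^bsup>(1)\<^esup> - \<chi>\<^sub>0) f\<close>. The determinant of \<open>A(\<chi>)\<close> is the
  obstruction to a logarithm-free solution with exponent \<open>1/2 - \<ell>\<close> of \<open>y'' = 2 S y\<close>, and the factorization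
  \<open>\<partial>\<^sup>2 - 2 S = (\<partial> + \<chi>\<^bsup>(1)\<^esup>)(\<partial> - \<chi>\<^bsup>(1)\<^esup>)\<close> identifies that obstruction with the same coefficient.
\<close>

subsection \<open>First order equations for power series\<close>

no_notation vec_index (infixl "$" 100)

lemma fps_X_deriv_nth: "(fps_X * fps_deriv F) $ n = of_nat n * F $ n" for F :: "'a::comm_ring_1 fps"
  by (cases n) simp_all

text \<open>Comparing coefficients gives a recursion: \<open>A $ 0 = 0\<close> keeps
  \<open>H $ n\<close> out of the right-hand side of the equation for \<open>n * H $ n\<close>, so
  everything follows from the constant term.\<close>

lemma theta_solution_unique:
  fixes A F G :: "complex fps"
  assumes A: "A $ 0 = 0" and F: "fps_X * fps_deriv F = A * F" and G: "fps_X * fps_deriv G = A * G"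
    and FG: "F $ 0 = G $ 0"
  shows "F = G"
proof -
  define H where "H = F - G"
  have H: "fps_X * fps_deriv H = A * H"
    using F G by (simp add: H_def algebra_simps)
  have "H $ n = 0" for n
  proof (induction n rule: less_induct)
    case (less n)
    show ?case
    proof (cases "n = 0")
      case True
      then show ?thesis using FG by (simp add: H_def)
    next
      case False
      have "of_nat n * H $ n = (A * H) $ n"
        by (simp flip: H add: fps_X_deriv_nth)
      also have "\<dots> = (\<Sum>i=0..n. A $ i * H $ (n - i))"
        by (simp add: fps_mult_nth)
      also have "\<dots> = 0"
      proof (rule sum.neutral, safe)
        fix i assume "i \<in> {0..n}"
        then show "A $ i * H $ (n - i) = 0"
          using A less[of "n - i"] False by (cases "i = 0") auto
      qed
      finally show ?thesis using False by simp
    qed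
  qed
  then show ?thesis by (auto simp: H_def fps_eq_iff)
qed

text \<open>The solution is the exponential of the integral of \<open>A / X\<close>, a power series
  because \<open>A $ 0 = 0\<close>.\<close>

lemma theta_solution_exists:
  fixes A :: "complex fps"
  assumes "A $ 0 = 0"
  obtains F where "F $ 0 = 1" "fps_X * fps_deriv F = A * F"
proof -
  define I where "I = fps_integral0 (fps_shift 1 A)"
  have [simp]: "fps_deriv I = fps_shift 1 A" and I0: "I $ 0 = 0"
    by (simp_all add: I_def fps_deriv_fps_integral)
  have XA: "fps_X * fps_shift 1 A = A"
    using assms by (intro fps_ext) (simp add: fps_X_mult_nth)
  let ?F = "fps_exp 1 oo I"
  have "fps_X * fps_deriv ?F = fps_X * fps_shift 1 A * ?F"
    using I0 by (simp add: fps_compose_deriv mult_ac)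
  then have "fps_X * fps_deriv ?F = A * ?F" unfolding XA .
  moreover have "?F $ 0 = 1" by simp
  ultimately show ?thesis using that by blast
qed

text \<open>The product rule lets \<open>f\<close> absorb the term \<open>A\<close>: multiplication
  by \<open>f\<close> turns \<theta> - A into \<theta>.\<close>

lemma theta_integrating_factor:
  fixes A f F :: "complex fps"
  assumes "fps_X * fps_deriv f = - A * f"
  shows "fps_X * fps_deriv (f * F) = f * (fps_X * fps_deriv F - A * F)"
proof -
  have "fps_X * fps_deriv (f * F) = (fps_X * fps_deriv f) * F + f * (fps_X * fps_deriv F)"
    by (simp add: algebra_simps)
  then show ?thesis unfolding assms by (simp add: algebra_simps)
qed

text \<open>With \<open>\<theta> = z d/dz\<close>, one has \<open>(\<theta> + A)(\<theta> - L - A) = \<theta>\<^sup>2 - L \<theta> - B\<close>, and \<open>f\<close> is an integrating factor of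
  both first order operators.\<close>

lemma frobenius_obstruction:
  fixes A f V :: "complex fps" and L :: nat
  defines "B \<equiv> fps_X * fps_deriv A + of_nat L * A + A * A"
  assumes A0: "A $ 0 = 0" and L: "L > 0"
    and f0: "f $ 0 = 1" and f: "fps_X * fps_deriv f = - A * f"
    and V0: "V $ 0 = 1"
    and V: "\<And>n. 0 < n \<Longrightarrow> n < L \<Longrightarrow> of_nat n * of_nat (L - n) * V $ n + (B * V) $ n = 0"
  shows "(B * V) $ L = - (of_nat L)\<^sup>2 * (f * f) $ L"
proof -
  \<comment> \<open>\<open>W\<close> and \<open>R\<close> apply the two first order factors in turn,
    so \<open>R\<close> is the full second order operator applied to \<open>V\<close>.\<close>
  define W where "W = fps_X * fps_deriv V - of_nat L * V - A * V"
  define R where "R = fps_X * fps_deriv W + A * W"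
  have R: "R = fps_X * fps_deriv (fps_X * fps_deriv V) - of_nat L * (fps_X * fps_deriv V) - B * V"
    unfolding R_def W_def B_def by (simp add: algebra_simps)
  have natnth: "(of_nat L * F) $ n = of_nat L * F $ n" for F :: "complex fps" and n
    by (metis fps_mult_left_const_nth fps_of_nat)
  have Rn: "R $ n = of_nat n * (of_nat n - of_nat L) * V $ n - (B * V) $ n" for n
    unfolding R by (simp add: fps_X_deriv_nth natnth algebra_simps del: fps_deriv_mult)
  have B0: "B $ 0 = 0" using A0 by (simp add: B_def natnth)
  have R0: "R $ n = 0" if "n < L" for n
  proof (cases "n = 0")
    case True
    then show ?thesis using B0 by (simp add: Rn)
  next
    case False
    then show ?thesis using V[of n] that unfolding Rn
      by (simp add: of_nat_diff algebra_simps)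
  qed
  have RL: "R $ L = - ((B * V) $ L)" by (simp add: Rn)
  \<comment> \<open>Conjugation by \<open>f\<close> makes the outer factor \<theta> + A into
    \<theta>. As \<open>R\<close> vanishes below index \<open>L\<close>, the quotient
    \<open>K\<close> has no coefficients strictly between \<open>0\<close> and
    \<open>L\<close>.\<close>
  define K where "K = inverse f * W"
  have fi: "f * inverse f = 1" using f0 by (metis inverse_mult_eq_1' one_neq_zero)
  have W: "W = f * K" unfolding K_def mult.assoc[symmetric] fi by simp
  have "R = f * (fps_X * fps_deriv K)"
  proof -
    have "R = f * (fps_X * fps_deriv K - A * K) + A * W"
      unfolding R_def by (simp add: W theta_integrating_factor[OF f] del: fps_deriv_mult)
    then show ?thesis by (simp add: W algebra_simps)
  qed
  then have KR: "fps_X * fps_deriv K = inverse f * R"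
    using fi by (metis mult.assoc mult.commute mult_1)
  have Kn: "of_nat n * K $ n = (\<Sum>i=0..n. inverse f $ i * R $ (n - i))" for n
    by (metis KR fps_X_deriv_nth fps_mult_nth)
  have K0: "K $ n = 0" if "0 < n" "n < L" for n
  proof -
    have "(\<Sum>i=0..n. inverse f $ i * R $ (n - i)) = 0"
      using R0 that by (intro sum.neutral) auto
    then show ?thesis using Kn[of n] that by simp
  qed
  have KL: "of_nat L * K $ L = R $ L"
  proof -
    have "(\<Sum>i=0..L. inverse f $ i * R $ (L - i)) = (\<Sum>i\<in>{0}. inverse f $ i * R $ (L - i))"
      using R0 by (intro sum.mono_neutral_right) auto
    then show ?thesis using Kn[of L] f0 by simp
  qed
  have K00: "K $ 0 = - of_nat L"
    using f0 V0 A0 by (simp add: K_def W_def natnth)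
  \<comment> \<open>This coefficient is computed twice: here from \<open>f * W = f * f * K\<close>,
    below from \<open>f * W = (\<theta> - L) (f * V)\<close>, where \<theta> - L kills index
    \<open>L\<close>.\<close>
  have "(f * W) $ L = (\<Sum>i=0..L. (f * f) $ i * K $ (L - i))"
    by (simp add: W fps_mult_nth[symmetric] mult.assoc)
  also have "\<dots> = (\<Sum>i\<in>{0, L}. (f * f) $ i * K $ (L - i))"
    using K0 by (intro sum.mono_neutral_right) auto
  also have "\<dots> = K $ L - of_nat L * (f * f) $ L"
    using L f0 K00 by simp
  finally have 1: "(f * W) $ L = K $ L - of_nat L * (f * f) $ L" .
  have "f * W = fps_X * fps_deriv (f * V) - of_nat L * (f * V)"
    unfolding theta_integrating_factor[OF f] W_def by (simp add: algebra_simps)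
  then have "(f * W) $ L = 0"
    by (simp add: fps_X_deriv_nth natnth del: fps_deriv_mult)
  with 1 have KL': "K $ L = of_nat L * (f * f) $ L" by simp
  have "(B * V) $ L = - (R $ L)" using RL by simp
  also have "R $ L = of_nat L * (of_nat L * (f * f) $ L)" unfolding KL[symmetric] KL' ..
  finally show ?thesis by (simp only: power2_eq_square mult.assoc mult_minus_left)
qed

lemma fps_compose_X_square_nth: "(F oo fps_X\<^sup>2) $ (2 * n) = F $ n" for F :: "complex fps"
proof -
  have "(F oo fps_X\<^sup>2) $ (2 * n) = (\<Sum>i=0..2 * n. F $ i * (fps_X ^ (2 * i)) $ (2 * n))"
    by (simp add: fps_compose_nth power_mult)
  also have "\<dots> = (\<Sum>i=0..2 * n. if i = n then F $ i else 0)"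
    by (intro sum.cong) auto
  finally show ?thesis by simp
qed

text \<open>The product g(X) g(-X) has logarithmic \<theta>-derivative -2 (a(X) + a(-X)), in which
  the odd part of \<open>a\<close> cancels. The series f(X^2)^2 has the same one and the same
  constant term, so uniqueness applies.\<close>

lemma even_part_integrating_factor:
  fixes a A f g :: "complex fps"
  assumes a0: "a $ 0 = 0" and A: "\<And>n. A $ n = a $ (2 * n)"
    and f0: "f $ 0 = 1" and f: "fps_X * fps_deriv f = - A * f"
    and g0: "g $ 0 = 1" and g: "fps_X * fps_deriv g = - 2 * a * g"
  shows "(g * (g oo - fps_X)) $ (2 * n) = (f * f) $ n"
proof -
  have m: "(F * G) oo - fps_X = (F oo - fps_X) * (G oo - fps_X)" 
    and m2: "(F * G) oo fps_X\<^sup>2 = (F oo fps_X\<^sup>2) * (G oo fps_X\<^sup>2)" for F G :: "complex fps"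
    by (simp_all add: fps_compose_mult_distrib)
  have aA: "a + (a oo - fps_X) = 2 * (A oo fps_X\<^sup>2)"
  proof (rule fps_ext)
    fix k
    have *: "(a oo - fps_X) $ k = (-1) ^ k * a $ k"
      using fps_compose_uminus' by (metis fps_nth_Abs_fps)
    show "(a + (a oo - fps_X)) $ k = (2 * (A oo fps_X\<^sup>2)) $ k"
    proof (cases "even k")
      case True
      then obtain j where "k = 2 * j" by blast
      then show ?thesis using * by (simp add: A fps_compose_X_square_nth numeral_fps_const)
    next
      case False
      have "(A oo fps_X\<^sup>2) $ k = (\<Sum>i=0..k. A $ i * (fps_X ^ (2 * i)) $ k)"
        by (simp add: fps_compose_nth power_mult)
      also have "\<dots> = 0" using False by (intro sum.neutral) auto
      finally show ?thesis using * False by (simp add: numeral_fps_const)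
    qed
  qed
  define c where "c = - 4 * (A oo fps_X\<^sup>2)"
  have c0: "c $ 0 = 0" using a0 A[of 0] by (simp add: c_def)
  have gm: "fps_X * fps_deriv (g oo - fps_X) = - 2 * (a oo - fps_X) * (g oo - fps_X)"
  proof -
    have "fps_X * fps_deriv (g oo - fps_X) = (fps_X * fps_deriv g) oo - fps_X"
      by (simp add: fps_compose_deriv m)
    also have "\<dots> = - 2 * (a oo - fps_X) * (g oo - fps_X)"
      unfolding g m by (simp add: fps_compose_uminus numeral_fps_const)
    finally show ?thesis .
  qed
  have 1: "fps_X * fps_deriv (g * (g oo - fps_X)) = c * (g * (g oo - fps_X))"
  proof -
    have "fps_X * fps_deriv (g * (g oo - fps_X))
        = (fps_X * fps_deriv g) * (g oo - fps_X) + g * (fps_X * fps_deriv (g oo - fps_X))"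
      by (simp add: algebra_simps)
    also have "\<dots> = - 2 * (a + (a oo - fps_X)) * (g * (g oo - fps_X))"
      unfolding g gm by (simp add: algebra_simps)
    finally show ?thesis unfolding aA c_def by (simp add: algebra_simps)
  qed
  have 2: "fps_X * fps_deriv ((f * f) oo fps_X\<^sup>2) = c * ((f * f) oo fps_X\<^sup>2)"
  proof -
    have "fps_X * fps_deriv ((f * f) oo fps_X\<^sup>2) = 2 * ((fps_X * fps_deriv (f * f)) oo fps_X\<^sup>2)"
    proof -
      have "fps_deriv (fps_X\<^sup>2 :: complex fps) = 2 * fps_X"
        by (simp add: power2_eq_square)
      then have "fps_deriv ((f * f) oo fps_X\<^sup>2) = (fps_deriv (f * f) oo fps_X\<^sup>2) * (2 * fps_X)"
        by (subst fps_compose_deriv) simp_all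
      moreover have "(fps_X * fps_deriv (f * f)) oo fps_X\<^sup>2 = fps_X\<^sup>2 * (fps_deriv (f * f) oo fps_X\<^sup>2)"
        unfolding m2 by simp
      ultimately show ?thesis by (simp add: power2_eq_square)
    qed
    also have "fps_X * fps_deriv (f * f) = 2 * (f * (fps_X * fps_deriv f))"
      by (simp add: algebra_simps)
    also have "\<dots> = - 2 * A * (f * f)"
      unfolding f by (simp add: algebra_simps)
    also have "2 * ((- 2 * A * (f * f)) oo fps_X\<^sup>2) = c * ((f * f) oo fps_X\<^sup>2)"
    proof -
      have "(- 2 :: complex fps) oo fps_X\<^sup>2 = - 2"
        by (simp add: fps_compose_uminus numeral_fps_const)
      moreover have "2 * (- 2 * x * y) = - 4 * x * y" for x y :: "complex fps"
        by simp
      ultimately show ?thesis unfolding m2 c_def by (simp only:)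
    qed
    finally show ?thesis .
  qed
  have "g * (g oo - fps_X) = (f * f) oo fps_X\<^sup>2"
    by (rule theta_solution_unique[OF c0 1 2]) (simp add: f0 g0)
  then show ?thesis by (simp add: fps_compose_X_square_nth)
qed

subsection \<open>The determinant\<close>

text \<open>Since the subdiagonal is nonzero, column \<open>j\<close> expresses entry
  \<open>j + 1\<close> of a left null vector through the earlier entries. Such a vector is therefore
  a multiple of \<open>v\<close>, and only the last column is left as a condition.\<close>

lemma det_hessenberg_eq_0_iff:
  fixes M :: "'a::field mat" and v :: "nat \<Rightarrow> 'a"
  assumes M: "M \<in> carrier_mat L L" and L: "L > 0"
    and below: "\<And>i j. i < L \<Longrightarrow> j < L \<Longrightarrow> j + 1 < i \<Longrightarrow> M $$ (i, j) = 0"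
    and sub: "\<And>j. j + 1 < L \<Longrightarrow> M $$ (j + 1, j) \<noteq> 0"
    and v0: "v 0 = 1"
    and v: "\<And>j. j + 1 < L \<Longrightarrow> (\<Sum>i<L. v i * M $$ (i, j)) = 0"
  shows "det M = 0 \<longleftrightarrow> (\<Sum>i<L. v i * M $$ (i, L - 1)) = 0"
proof -
  have MT: "transpose_mat M \<in> carrier_mat L L" using M by simp
  have ent: "vec_index (transpose_mat M *\<^sub>v u) j = (\<Sum>i<L. vec_index u i * M $$ (i, j))"
    if "u \<in> carrier_vec L" "j < L" for u j
    using M that by (auto simp: scalar_prod_def mult.commute atLeast0LessThan intro!: sum.cong)
  have "det M = 0 \<longleftrightarrow> (\<exists>u. u \<in> carrier_vec L \<and> u \<noteq> 0\<^sub>v L \<and> transpose_mat M *\<^sub>v u = 0\<^sub>v L)"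
    using det_0_iff_vec_prod_zero[OF MT] det_transpose[OF M] by simp
  also have "\<dots> \<longleftrightarrow> (\<Sum>i<L. v i * M $$ (i, L - 1)) = 0"
  proof
    assume "(\<Sum>i<L. v i * M $$ (i, L - 1)) = 0"
    then have col: "(\<Sum>i<L. v i * M $$ (i, j)) = 0" if "j < L" for j
    proof (cases "j + 1 < L")
      case False
      then have "j = L - 1" using that by simp
      then show ?thesis using \<open>(\<Sum>i<L. v i * M $$ (i, L - 1)) = 0\<close> by simp
    qed (rule v)
    have "transpose_mat M *\<^sub>v vec L v = 0\<^sub>v L"
    proof (rule eq_vecI)
      fix j assume "j < dim_vec (0\<^sub>v L :: 'a vec)"
      then show "vec_index (transpose_mat M *\<^sub>v vec L v) j = vec_index (0\<^sub>v L) j"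
        using col[of j] by (simp add: ent del: index_mult_mat_vec)
    qed (use M in simp)
    moreover have "vec L v \<noteq> 0\<^sub>v L"
      using L v0 by (metis index_vec index_zero_vec(1) one_neq_zero)
    ultimately show "\<exists>u. u \<in> carrier_vec L \<and> u \<noteq> 0\<^sub>v L \<and> transpose_mat M *\<^sub>v u = 0\<^sub>v L"
      by (metis vec_carrier)
  next
    assume "\<exists>u. u \<in> carrier_vec L \<and> u \<noteq> 0\<^sub>v L \<and> transpose_mat M *\<^sub>v u = 0\<^sub>v L"
    then obtain u where u: "u \<in> carrier_vec L" "u \<noteq> 0\<^sub>v L" "transpose_mat M *\<^sub>v u = 0\<^sub>v L" by blast
    have col: "(\<Sum>i<L. vec_index u i * M $$ (i, j)) = 0" if "j < L" for j
      using ent[OF u(1) that] u(3) that by simp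
    have uv: "i < L \<longrightarrow> vec_index u i = vec_index u 0 * v i" for i
    proof (induction i rule: less_induct)
      case (less i)
      show ?case
      proof (cases i)
        case 0
        then show ?thesis by (simp add: v0)
      next
        case (Suc j)
        show ?thesis
        proof
          assume iL: "i < L"
          \<comment> \<open>The difference of \<open>u\<close> and \<open>u_0 v\<close> annihilates
            column \<open>j\<close>. Its entries before row \<open>i = j + 1\<close> vanish by
            induction, and the matrix entries after row \<open>i\<close> vanish by shape, so only
            row \<open>i\<close> remains.\<close>
          have "(\<Sum>k<L. (vec_index u k - vec_index u 0 * v k) * M $$ (k, j))
              = (\<Sum>k<L. vec_index u k * M $$ (k, j)) - vec_index u 0 * (\<Sum>k<L. v k * M $$ (k, j))"
            by (simp add: sum_distrib_left sum_subtractf algebra_simps)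
          also have "\<dots> = 0" using col[of j] v[of j] iL Suc by simp
          finally have "0 = (\<Sum>k<L. (vec_index u k - vec_index u 0 * v k) * M $$ (k, j))" by simp
          also have "\<dots> = (\<Sum>k\<in>{i}. (vec_index u k - vec_index u 0 * v k) * M $$ (k, j))"
          proof (rule sum.mono_neutral_right)
            show "\<forall>k\<in>{..<L} - {i}. (vec_index u k - vec_index u 0 * v k) * M $$ (k, j) = 0"
            proof
              fix k assume k: "k \<in> {..<L} - {i}"
              show "(vec_index u k - vec_index u 0 * v k) * M $$ (k, j) = 0"
                using less[of k] below[of k j] k iL Suc by (cases "k < i") auto
            qed
          qed (use iL in auto)
          finally show "vec_index u i = vec_index u 0 * v i" using sub[of j] iL Suc by simp
        qed
      qed
    qed
    have "vec_index u 0 \<noteq> 0"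
    proof
      assume u0: "vec_index u 0 = 0"
      have "u = 0\<^sub>v L"
      proof (rule eq_vecI)
        fix i assume "i < dim_vec (0\<^sub>v L :: 'a vec)"
        then show "vec_index u i = vec_index (0\<^sub>v L) i" using uv[of i] u0 by simp
      qed (use u(1) in simp)
      with u(2) show False by simp
    qed
    moreover have "vec_index u 0 * (\<Sum>i<L. v i * M $$ (i, L - 1)) = 0"
    proof -
      have "vec_index u 0 * (\<Sum>i<L. v i * M $$ (i, L - 1)) = (\<Sum>i<L. vec_index u i * M $$ (i, L - 1))"
        unfolding sum_distrib_left
      proof (rule sum.cong[OF refl])
        fix i assume "i \<in> {..<L}"
        then have "vec_index u i = vec_index u 0 * v i" using uv[of i] by simp
        then show "vec_index u 0 * (v i * M $$ (i, L - 1)) = vec_index u i * M $$ (i, L - 1)"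
          by (metis mult.assoc)
      qed
      then show ?thesis using col[of "L - 1"] L by simp
    qed
    ultimately show "(\<Sum>i<L. v i * M $$ (i, L - 1)) = 0" by simp
  qed
  finally show ?thesis .
qed

text \<open>This is \<open>z \<chi>\<^bsup>(1)\<^esup>(z) - \<chi>\<^sub>0\<close> for \<open>p = 0\<close>.\<close>

definition chi_even :: "complex fls \<Rightarrow> complex fps" where
  "chi_even chi = Abs_fps (\<lambda>n. if n = 0 then 0 else chi_coeff chi (- 2 * int n))"

text \<open>For s = z \<chi>^(1) one has z^2 ((\<chi>^(1))^2 + \<partial>\<chi>^(1)) = s^2 +
  \<theta> s - s. As 2 \<chi>_0 = L + 1, the linear terms 2 \<chi>_0 A - A combine to L A;
  \<open>j > 0\<close> discards the constants.\<close>

lemma S_coeff_eq: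
  assumes expansion: "\<forall>h>0. chi_coeff chi h = 0"
    and chi0: "chi_coeff chi 0 = (of_nat L + 1) / 2" and j: "j > 0"
  shows "2 * S_coeff chi (- int j) = (fps_X * fps_deriv (chi_even chi) + of_nat L * chi_even chi
    + chi_even chi * chi_even chi) $ j"
proof -
  let ?A = "chi_even chi"
  define s where "s = fps_const (chi_coeff chi 0) + ?A"
  have s: "s $ n = chi_coeff chi (- 2 * int n)" for n
    by (simp add: s_def chi_even_def)
  have ip: "integral_part chi = fls_shift 1 (fps_to_fls s)"
  proof (rule fls_eqI)
    fix m :: int
    have "fls_nth chi (2 * m) = chi_coeff chi (- 2 * (m + 1))"
      by (simp add: chi_coeff_def)
    then show "fls_nth (integral_part chi) m = fls_nth (fls_shift 1 (fps_to_fls s)) m"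
      using expansion by (auto simp: fls_nth_integral_part s)
  qed
  have sq: "(integral_part chi)\<^sup>2 = fls_shift 2 (fps_to_fls (s * s))"
    unfolding ip power2_eq_square by (simp add: fls_times_both_shifted_simp fls_times_fps_to_fls)
  have "2 * S_coeff chi (- int j) = fls_nth ((integral_part chi)\<^sup>2 + fls_deriv (integral_part chi)) (int j - 2)"
    by (simp add: S_coeff_def S_series_def)
  also have "\<dots> = (s * s) $ j + (of_nat j - 1) * s $ j"
    unfolding sq using j by (simp add: ip nat_diff_distrib flip: fps_mult_nth)
  also have "s * s = fps_const ((chi_coeff chi 0)\<^sup>2) + fps_const (2 * chi_coeff chi 0) * ?A + ?A * ?A"
    unfolding s_def by (simp add: algebra_simps power2_eq_square flip: fps_const_mult fps_const_add)
  finally have "2 * S_coeff chi (- int j)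
      = (2 * chi_coeff chi 0) * ?A $ j + (?A * ?A) $ j + (of_nat j - 1) * ?A $ j"
    using j by (simp add: s_def)
  then have "2 * S_coeff chi (- int j)
      = (of_nat L + 1) * ?A $ j + (?A * ?A) $ j + (of_nat j - 1) * ?A $ j"
    by (simp only: chi0) simp
  moreover have "(of_nat L * ?A) $ j = of_nat L * ?A $ j"
    by (metis fps_mult_left_const_nth fps_of_nat)
  ultimately show ?thesis
    unfolding fps_add_nth fps_X_deriv_nth by (simp add: algebra_simps)
qed

text \<open>The denominator vanishes at \<open>n = L\<close>; only the values for \<open>n < L\<close> are meaningful.\<close>

fun frobenius_coeff :: "(nat \<Rightarrow> complex) \<Rightarrow> nat \<Rightarrow> nat \<Rightarrow> complex" where
  "frobenius_coeff b L n = (if n = 0 then 1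
     else - (\<Sum>j=1..n. b j * frobenius_coeff b L (n - j)) / (of_nat n * of_nat (L - n)))"

declare frobenius_coeff.simps [simp del]

text \<open>Column \<open>j\<close> of the matrix is the Frobenius recursion at index
  \<open>j + 1\<close>, so the row vector \<open>v\<close> annihilates all columns but the last. The
  last one yields \<open>(B * V) $ L\<close>, the obstruction computed in
  \<open>frobenius_obstruction\<close>.\<close>

lemma det_A_matrix_eq_0_iff:
  assumes expansion: "\<forall>h>0. chi_coeff chi h = 0"
    and chi0: "chi_coeff chi 0 = (of_nat L + 1) / 2" and L: "L > 0"
    and f0: "f $ 0 = 1" and f: "fps_X * fps_deriv f = - chi_even chi * f"
  shows "det (A_matrix chi L) = 0 \<longleftrightarrow> (f * f) $ L = 0"
proof -
  define B where "B = fps_X * fps_deriv (chi_even chi) + of_nat L * chi_even chi + chi_even chi * chi_even chi"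
  define v where "v = frobenius_coeff (fps_nth B) L"
  define V where "V = Abs_fps v"
  let ?M = "A_matrix chi L"
  have A0: "chi_even chi $ 0 = 0" by (simp add: chi_even_def)
  have B0: "B $ 0 = 0"
    using A0 by (simp add: B_def)
  have S: "2 * S_coeff chi (- int j) = B $ j" if "j > 0" for j
    unfolding B_def by (rule S_coeff_eq[OF expansion chi0 that])
  have M: "?M \<in> carrier_mat L L" by (simp add: A_matrix_def)
  have ent: "?M $$ (i, j) = (if i \<le> j then B $ (j + 1 - i)
      else if i = j + 1 then of_nat (j + 1) * of_nat (L - (j + 1)) else 0)" if "i < L" "j < L" for i j
  proof -
    \<comment> \<open>The subdiagonal entry factors as \<open>b (L - b)\<close>, the indicial factor
      of the recursion.\<close>
    have "(of_nat L / 2)\<^sup>2 - (of_nat L / 2 - of_nat (j + 1))\<^sup>2 = (of_nat (j + 1) * of_nat (L - (j + 1)) :: complex)"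
      using that by (simp add: of_nat_diff power2_eq_square field_simps)
    then show ?thesis
      using that S[of "j + 1 - i"] by (simp add: A_matrix_def Let_def of_nat_diff algebra_simps)
  qed
  have BV: "(B * V) $ n = (\<Sum>j=1..n. B $ j * v (n - j))" for n
    unfolding fps_mult_nth V_def using B0 by (simp add: sum.atLeast_Suc_atMost)
  have rec: "of_nat n * of_nat (L - n) * v n + (B * V) $ n = 0" if "0 < n" "n < L" for n
    unfolding BV using that by (subst v_def, subst frobenius_coeff.simps) (simp add: v_def)
  have v0: "v 0 = 1" by (simp add: v_def frobenius_coeff.simps)
  have col: "(\<Sum>i<L. v i * ?M $$ (i, j)) = (if j + 1 < L then of_nat (j + 1) * of_nat (L - (j + 1)) * v (j + 1) else 0)
      + (B * V) $ (j + 1)" if "j < L" for j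
  proof -
    have "(\<Sum>i<L. v i * ?M $$ (i, j)) = (\<Sum>i<L. v i * (if i \<le> j then B $ (j + 1 - i) else 0))
      + (\<Sum>i<L. if i = j + 1 then of_nat (j + 1) * of_nat (L - (j + 1)) * v (j + 1) else 0)"
      unfolding sum.distrib[symmetric] using that by (intro sum.cong) (auto simp: ent)
    also have "(\<Sum>i<L. v i * (if i \<le> j then B $ (j + 1 - i) else 0)) = (\<Sum>i\<le>j. v i * B $ (j + 1 - i))"
      using that by (intro sum.mono_neutral_cong_right) auto
    also have "\<dots> = (B * V) $ (j + 1)"
      unfolding BV by (rule sum.reindex_bij_witness[of _ "\<lambda>k. j + 1 - k" "\<lambda>k. j + 1 - k"]) auto
    finally show ?thesis by (simp add: add.commute)
  qed
  have "det ?M = 0 \<longleftrightarrow> (\<Sum>i<L. v i * ?M $$ (i, L - 1)) = 0"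
  proof (rule det_hessenberg_eq_0_iff[OF M L])
    show "(\<Sum>i<L. v i * ?M $$ (i, j)) = 0" if "j + 1 < L" for j
      using col[of j] rec[of "j + 1"] that by simp
    show "?M $$ (j + 1, j) \<noteq> 0" if "j + 1 < L" for j
    proof -
      have "of_nat (j + 1) * of_nat (L - (j + 1)) \<noteq> (0 :: complex)"
        unfolding mult_eq_0_iff of_nat_eq_0_iff using that by simp
      then show ?thesis using that by (simp add: ent)
    qed
  qed (simp_all add: ent v0)
  also have "(\<Sum>i<L. v i * ?M $$ (i, L - 1)) = (B * V) $ L"
    using col[of "L - 1"] L by simp
  also have "\<dots> = - (of_nat L)\<^sup>2 * (f * f) $ L"
    unfolding B_def
    by (rule frobenius_obstruction[OF A0 L f0 f]) (use rec in \<open>simp_all add: V_def v0 B_def\<close>)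
  finally show ?thesis using L by simp
qed

subsection \<open>Infinite combinations of Clifford modes\<close>

definition vanishes_below :: "int \<Rightarrow> (int \<Rightarrow> complex) \<Rightarrow> bool" where
  "vanishes_below a x \<longleftrightarrow> (\<forall>m<a. x m = 0)"

text \<open>Up to sign, the anticommutator of \<open>\<Sum>\<^sub>m x\<^sub>m \<Phi>(m/2)\<close> and \<open>\<Sum>\<^sub>m y\<^sub>m \<Phi>(m/2)\<close>. \<open>Sum_any\<close> is \<open>0\<close> on infinite
  supports, so this is only used for families that vanish for small indices.\<close>

definition pairing :: "(int \<Rightarrow> complex) \<Rightarrow> (int \<Rightarrow> complex) \<Rightarrow> complex" where
  "pairing x y = Sum_any (\<lambda>m. (-1) powi m * x (- m) * y m)"

definition delta :: "int \<Rightarrow> int \<Rightarrow> complex" where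
  "delta j m = (if m = j then 1 else 0)"

lemma vanishes_below_mono: "vanishes_below a x \<Longrightarrow> b \<le> a \<Longrightarrow> vanishes_below b x"
  by (auto simp: vanishes_below_def)

lemma vanishes_below_delta: "vanishes_below j (delta j)"
  by (simp add: vanishes_below_def delta_def)

lemma vanishes_below_linear:
  "vanishes_below a x \<Longrightarrow> vanishes_below a y \<Longrightarrow> vanishes_below a (\<lambda>m. x m + c * y m)"
  by (simp add: vanishes_below_def)

lemma pairing_eq_sum:
  assumes "vanishes_below a x" "vanishes_below b y" "b' \<le> b" "- a \<le> a'"
  shows "pairing x y = (\<Sum>m=b'..a'. (-1) powi m * x (- m) * y m)"
  unfolding pairing_def
proof (rule Sum_any.expand_superset)
  show "{m. (-1) powi m * x (- m) * y m \<noteq> 0} \<subseteq> {b'..a'}"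
  proof
    fix m assume "m \<in> {m. (-1) powi m * x (- m) * y m \<noteq> 0}"
    then have "\<not> - m < a" "\<not> m < b"
      using assms(1,2) unfolding vanishes_below_def by auto
    then show "m \<in> {b'..a'}" using assms by auto
  qed
qed simp

lemma pairing_linear_left:
  assumes "vanishes_below a x" "vanishes_below a x'" "vanishes_below b y"
  shows "pairing (\<lambda>m. x m + c * x' m) y = pairing x y + c * pairing x' y"
  using assms vanishes_below_linear[OF assms(1,2), of c]
  by (simp add: pairing_eq_sum[of a _ b _ b "- a"] sum_distrib_left sum.distrib[symmetric] algebra_simps)

lemma pairing_linear_right:
  assumes "vanishes_below a x" "vanishes_below b y" "vanishes_below b y'"
  shows "pairing x (\<lambda>m. y m + c * y' m) = pairing x y + c * pairing x y'"
  using assms vanishes_below_linear[OF assms(2,3), of c]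
  by (simp add: pairing_eq_sum[of a _ b _ b "- a"] sum_distrib_left sum.distrib[symmetric] algebra_simps)

lemma pairing_delta_right: "pairing x (delta j) = (-1) powi j * x (- j)"
  unfolding pairing_def delta_def
  using Sum_any.delta[of j "\<lambda>m. (-1) powi m * x (- m)"] by (simp add: if_distrib cong: if_cong)

lemma pairing_delta_left: "pairing (delta j) y = (-1) powi j * y (- j)"
proof -
  have "pairing (delta j) y = Sum_any (\<lambda>m. if m = - j then (-1) powi m * y m else 0)"
    unfolding pairing_def delta_def by (rule Sum_any.cong) auto
  also have "\<dots> = (-1) powi (- j) * y (- j)" by simp
  finally show ?thesis by (simp add: power_int_minus_one_minus)
qed

section \<open>The twisted Fock module and the uniqueness of its vacuum\<close>

locale twisted_fock =
  fixes i :: nat and smul :: "complex \<Rightarrow> 'v \<Rightarrow> 'v::ab_group_add"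
    and \<Phi> :: "int \<Rightarrow> 'v \<Rightarrow> 'v" and vac :: 'v
  assumes F: "is_F_T i smul \<Phi> vac"
begin

sublocale vector_space smul
  using F unfolding is_F_T_def CLtw_module_def by blast

lemma linear_Phi: "Vector_Spaces.linear smul smul (\<Phi> h)"
  using F unfolding is_F_T_def CLtw_module_def by blast

lemma module_hom_Phi: "module_hom smul smul (\<Phi> h)"
  using linear_Phi by (simp add: Vector_Spaces.linear_def)

lemma Phi_add: "\<Phi> h (v + w) = \<Phi> h v + \<Phi> h w"
  by (rule module_hom.add[OF module_hom_Phi])

lemma Phi_scale: "\<Phi> h (smul c v) = smul c (\<Phi> h v)"
  by (rule module_hom.scale[OF module_hom_Phi])

lemma Phi_zero: "\<Phi> h 0 = 0"
  using Phi_scale[of h 0 0] by simp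

lemma Phi_minus: "\<Phi> h (- v) = - \<Phi> h v"
  using Phi_scale[of h "-1" v] by simp

lemma Phi_sum: "\<Phi> h (\<Sum>k\<in>A. f k) = (\<Sum>k\<in>A. \<Phi> h (f k))"
  by (induction A rule: infinite_finite_induct) (auto simp: Phi_zero Phi_add)

lemma clifford: "\<Phi> h (\<Phi> k v) + \<Phi> k (\<Phi> h v) = smul (if h + k = 0 then - ((-1) powi h) else 0) v"
proof -
  have "CLtw_module smul \<Phi>" using F by (simp add: is_F_T_def)
  then have "\<forall>h k v. \<Phi> h (\<Phi> k v) + \<Phi> k (\<Phi> h v) = smul (- ((-1) powi h) * (if h + k = 0 then 1 else 0)) v"
    unfolding CLtw_module_def by (elim conjE)
  then have "\<Phi> h (\<Phi> k v) + \<Phi> k (\<Phi> h v) = smul (- ((-1) powi h) * (if h + k = 0 then 1 else 0)) v"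
    by (elim allE)
  moreover have "- ((-1) powi h) * (if h + k = 0 then 1 else 0) = (if h + k = 0 then - ((-1) powi h) else (0::complex))"
    by simp
  ultimately show ?thesis by (simp only:)
qed

lemma anticommute: "h + k \<noteq> 0 \<Longrightarrow> \<Phi> h (\<Phi> k v) = - \<Phi> k (\<Phi> h v)"
  using clifford[of h k v] by (simp add: eq_neg_iff_add_eq_0)

lemma scale_two: "smul 2 v = v + v"
  using scale_left_distrib[of 1 1 v] by simp

lemma self_double_eq_0: "v + v = 0 \<Longrightarrow> v = 0" for v :: 'v
  unfolding scale_two[symmetric] by simp

lemma Phi_square: "h \<noteq> 0 \<Longrightarrow> \<Phi> h (\<Phi> h v) = 0"
  using clifford[of h h v] self_double_eq_0[of "\<Phi> h (\<Phi> h v)"] by simp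

definition eps :: complex where "eps = (-1) ^ i * (1 / csqrt (-2))"

lemma eps_nonzero: "eps \<noteq> 0"
  by (simp add: eps_def)

lemma Phi_vac: "h \<ge> 0 \<Longrightarrow> \<Phi> h vac = smul (if h = 0 then eps else 0) vac"
  using F unfolding is_F_T_def eps_def by auto

lemma cyclic:
  assumes "subspace U" "\<And>h u. u \<in> U \<Longrightarrow> \<Phi> h u \<in> U" "vac \<in> U"
  shows "U = UNIV"
  using F assms unfolding is_F_T_def by blast

lemma irreducible:
  assumes "subspace U" "\<And>h u. u \<in> U \<Longrightarrow> \<Phi> h u \<in> U"
  shows "U = {0} \<or> U = UNIV"
  using F assms unfolding is_F_T_def irreducible_action_def by blast

lemma vac_nonzero: "vac \<noteq> 0"
proof
  assume "vac = 0"
  then have "{0} = (UNIV :: 'v set)"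
    by (intro cyclic) (auto simp: Phi_zero)
  moreover obtain v :: 'v where "v \<noteq> 0"
    using F unfolding is_F_T_def irreducible_action_def by blast
  ultimately show False by blast
qed

text \<open>The vectors with this property form a Clifford-invariant subspace containing
  \<open>vac\<close>. This makes infinite sums of modes finite on each vector.\<close>

lemma annihilated: "\<exists>N. \<forall>h>N. \<Phi> h v = 0"
proof -
  let ?U = "{v. \<exists>N. \<forall>h>N. \<Phi> h v = 0}"
  have "?U = UNIV"
  proof (rule cyclic)
    show "subspace ?U"
    proof (rule subspaceI)
      fix x y assume "x \<in> ?U" "y \<in> ?U"
      then obtain M N where "\<forall>h>M. \<Phi> h x = 0" "\<forall>h>N. \<Phi> h y = 0" by blast
      then have "\<forall>h>max M N. \<Phi> h (x + y) = 0" by (simp add: Phi_add)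
      then show "x + y \<in> ?U" by blast
    qed (auto simp: Phi_zero Phi_scale)
  next
    fix k u assume "u \<in> ?U"
    then obtain N where N: "\<forall>h>N. \<Phi> h u = 0" by blast
    have "\<forall>h>max N \<bar>k\<bar>. \<Phi> h (\<Phi> k u) = 0"
      using N by (auto simp: anticommute Phi_zero)
    then show "\<Phi> k u \<in> ?U" by blast
  next
    have "\<forall>h>0. \<Phi> h vac = 0" using Phi_vac by simp
    then show "vac \<in> ?U" by blast
  qed
  then show ?thesis by blast
qed

lemma annihilated_finite:
  assumes "finite A"
  shows "\<exists>b\<ge>c. \<forall>v\<in>A. \<forall>h>b. \<Phi> h v = 0"
  using assms
proof induction
  case (insert v A)
  then obtain b where b: "b \<ge> c" "\<forall>v\<in>A. \<forall>h>b. \<Phi> h v = 0" by blast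
  obtain N where "\<forall>h>N. \<Phi> h v = 0" using annihilated by blast
  with b have "max b N \<ge> c \<and> (\<forall>v\<in>insert v A. \<forall>h>max b N. \<Phi> h v = 0)" by auto
  then show ?case by blast
qed auto

text \<open>Each factor \<open>-(-1)\<^sup>h \<Phi>(h/2) \<Phi>(-h/2)\<close> is the projection onto the kernel of \<open>\<Phi>(h/2)\<close> along the image of
  \<open>\<Phi>(-h/2)\<close>.\<close>

primrec lower_proj :: "nat \<Rightarrow> 'v \<Rightarrow> 'v" where
  "lower_proj 0 v = v"
| "lower_proj (Suc M) v = smul (- ((-1) powi int (Suc M))) (\<Phi> (int (Suc M)) (\<Phi> (- int (Suc M)) (lower_proj M v)))"

lemma lower_proj_add: "lower_proj M (v + w) = lower_proj M v + lower_proj M w"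
  by (induction M) (simp_all add: Phi_add scale_right_distrib)

lemma lower_proj_scale: "lower_proj M (smul c v) = smul c (lower_proj M v)"
  by (induction M) (simp_all add: Phi_scale mult.commute)

lemma lower_proj_zero: "lower_proj M 0 = 0"
  using lower_proj_scale[of M 0 0] by simp

lemma lower_proj_commute: "h > int M \<Longrightarrow> lower_proj M (\<Phi> (- h) v) = \<Phi> (- h) (lower_proj M v)"
proof (induction M)
  case (Suc M)
  have *: "\<Phi> k (\<Phi> (- k) (\<Phi> (- h) w)) = \<Phi> (- h) (\<Phi> k (\<Phi> (- k) w))" if "k > 0" "k < h" for k w
  proof -
    have "\<Phi> k (\<Phi> (- k) (\<Phi> (- h) w)) = - \<Phi> k (\<Phi> (- h) (\<Phi> (- k) w))"
      using that by (subst anticommute) (simp_all add: Phi_minus)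
    also have "\<dots> = \<Phi> (- h) (\<Phi> k (\<Phi> (- k) w))"
      using that by (subst anticommute) simp_all
    finally show ?thesis .
  qed
  have IH: "lower_proj M (\<Phi> (- h) v) = \<Phi> (- h) (lower_proj M v)"
    using Suc by simp
  have "0 < int (Suc M)" "int (Suc M) < h" using Suc.prems by simp_all
  from *[OF this] show ?case unfolding lower_proj.simps IH Phi_scale by (rule arg_cong)
qed simp

lemma lower_proj_kill: "0 < h \<Longrightarrow> h \<le> int M \<Longrightarrow> lower_proj M (\<Phi> (- h) v) = 0"
proof (induction M)
  case (Suc M)
  show ?case
  proof (cases "h = int (Suc M)")
    case True
    have "lower_proj M (\<Phi> (- h) v) = \<Phi> (- h) (lower_proj M v)"
      using True by (intro lower_proj_commute) simp
    then show ?thesis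
      unfolding lower_proj.simps True using Phi_square[of "- int (Suc M)"] by (simp only: Phi_zero) simp
  next
    case False
    then have "lower_proj M (\<Phi> (- h) v) = 0" using Suc by simp
    then show ?thesis by (simp only: lower_proj.simps Phi_zero scale_zero_right)
  qed
qed simp

lemma lower_proj_fixed:
  assumes "\<And>h. h > 0 \<Longrightarrow> \<Phi> h v = 0"
  shows "lower_proj M v = v"
proof (induction M)
  case (Suc M)
  have step: "smul (- ((-1) powi h)) (\<Phi> h (\<Phi> (- h) v)) = v" if "h > 0" for h
  proof -
    have "\<Phi> h (\<Phi> (- h) v) = smul (- ((-1) powi h)) v"
      using clifford[of h "- h" v] assms[OF that] by (simp only: Phi_zero) simp
    then show ?thesis by (simp only: scale_scale) simp
  qed
  have "int (Suc M) > 0" by simp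
  from step[OF this] show ?case unfolding lower_proj.simps Suc .
qed simp

inductive_set fock_monomials :: "'v set" where
  vac: "vac \<in> fock_monomials"
| Phi: "v \<in> fock_monomials \<Longrightarrow> h < 0 \<Longrightarrow> \<Phi> h v \<in> fock_monomials"

lemma subspace_vimage_Phi: "subspace U \<Longrightarrow> subspace {v. \<Phi> h v \<in> U}"
  by (rule subspaceI) (auto simp: Phi_zero Phi_add Phi_scale subspace_0 subspace_add subspace_scale)

text \<open>A mode with \<open>h \<ge> 0\<close> is moved past the creation modes to
  \<open>vac\<close>, where it acts by a scalar; each contraction leaves a shorter monomial.\<close>

lemma span_fock_monomials: "span fock_monomials = UNIV"
proof (rule cyclic)
  have neg: "\<Phi> h u \<in> span fock_monomials" if "u \<in> span fock_monomials" "h < 0" for h u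
  proof -
    have "span fock_monomials \<subseteq> {v. \<Phi> h v \<in> span fock_monomials}"
      by (rule span_minimal) (use that in \<open>auto intro: span_base fock_monomials.Phi subspace_vimage_Phi\<close>)
    then show ?thesis using that by blast
  qed
  have mono: "\<Phi> h u \<in> span fock_monomials" if "u \<in> fock_monomials" "h \<ge> 0" for h u
    using that
  proof (induction rule: fock_monomials.induct)
    case vac
    then show ?case by (auto simp: Phi_vac intro: span_scale span_base span_zero fock_monomials.vac)
  next
    case (Phi v k)
    have "\<Phi> h (\<Phi> k v) = smul (if h + k = 0 then - ((-1) powi h) else 0) v - \<Phi> k (\<Phi> h v)"
      using clifford[of h k v] by (simp add: eq_diff_eq)
    moreover have "v \<in> span fock_monomials" using Phi by (simp add: span_base)
    ultimately show ?case using Phi neg by (simp only: span_diff span_scale)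
  qed
  show "\<Phi> h u \<in> span fock_monomials" if "u \<in> span fock_monomials" for h u
  proof (cases "h < 0")
    case False
    have "span fock_monomials \<subseteq> {v. \<Phi> h v \<in> span fock_monomials}"
      by (rule span_minimal) (use False mono in \<open>auto intro: subspace_vimage_Phi\<close>)
    then show ?thesis using that by blast
  qed (use that neg in blast)
qed (auto intro: span_base fock_monomials.vac)

text \<open>A monomial starting with a creation mode \<open>\<Phi> h\<close> is killed by
  \<open>lower_proj M\<close> once \<open>M \<ge> - h\<close>, so on every vector
  \<open>lower_proj M\<close> eventually lands in the line of \<open>vac\<close>. But it fixes
  vectors killed by all positive modes.\<close>

lemma vacuum_unique:
  assumes pos: "\<And>h. h > 0 \<Longrightarrow> \<Phi> h n = 0"
  shows "\<exists>c. n = smul c vac"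
proof -
  let ?Z = "{v. \<exists>c N. \<forall>M\<ge>N. lower_proj M v = smul c vac}"
  have "span fock_monomials \<subseteq> ?Z"
  proof (rule span_minimal)
    show "fock_monomials \<subseteq> ?Z"
    proof
      fix v assume "v \<in> fock_monomials"
      then show "v \<in> ?Z"
      proof cases
        case vac
        have "lower_proj M vac = smul 1 vac" for M
          using lower_proj_fixed[of vac M] Phi_vac by simp
        then show ?thesis using vac by blast
      next
        case (Phi w h)
        have "\<forall>M\<ge>nat (- h). lower_proj M v = smul 0 vac"
          using lower_proj_kill[of "- h" _ w] Phi by (auto simp: nat_le_iff)
        then show ?thesis by blast
      qed
    qed
    show "subspace ?Z"
    proof (rule subspaceI)
      have "\<forall>M\<ge>0. lower_proj M 0 = smul 0 vac" by (simp add: lower_proj_zero)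
      then show "0 \<in> ?Z" by blast
      fix x assume "x \<in> ?Z"
      then obtain c N where c: "\<forall>M\<ge>N. lower_proj M x = smul c vac" by blast
      have "\<forall>M\<ge>N. lower_proj M (smul d x) = smul (d * c) vac" for d
        using c by (simp add: lower_proj_scale)
      then show "smul d x \<in> ?Z" for d by blast
      fix y assume "y \<in> ?Z"
      then obtain c' N' where c': "\<forall>M\<ge>N'. lower_proj M y = smul c' vac" by blast
      have "\<forall>M\<ge>max N N'. lower_proj M (x + y) = smul (c + c') vac"
        using c c' by (simp add: lower_proj_add scale_left_distrib)
      then show "x + y \<in> ?Z" by blast
    qed
  qed
  then have "n \<in> ?Z" using span_fock_monomials by blast
  then obtain c N where "lower_proj N n = smul c vac" by blast
  then show ?thesis using lower_proj_fixed[OF pos] by auto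
qed

text \<open>By uniqueness \<open>n\<close> is a multiple of \<open>vac\<close>, on which
  \<open>\<Phi> 0\<close> acts by \<open>eps\<close>, and \<open>eps \<noteq> - eps\<close>.\<close>

lemma no_opposite_vacuum:
  assumes n: "\<And>h. h \<ge> 0 \<Longrightarrow> \<Phi> h n = smul (- (if h = 0 then eps else 0)) n"
  shows "n = 0"
proof -
  obtain c where c: "n = smul c vac"
    using vacuum_unique[of n] n by auto
  have "smul (- eps) n = smul eps n"
    using n[of 0] Phi_vac[of 0] by (simp add: c Phi_scale mult.commute)
  then have "smul (2 * eps) n = 0"
    using scale_left_diff_distrib[of eps "- eps" n] by simp
  then show ?thesis using eps_nonzero by simp
qed

section \<open>Operators given by infinite sums of modes\<close>

definition mode_sum :: "(int \<Rightarrow> complex) \<Rightarrow> 'v \<Rightarrow> 'v" where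
  "mode_sum x v = Sum_any (\<lambda>m. smul (x m) (\<Phi> m v))"

text \<open>The family bounds the support from below and the vector bounds it from above, so
  \<open>Sum_any\<close> never takes its default value.\<close>

lemma mode_sum_eq_sum:
  assumes x: "vanishes_below a x" and v: "\<forall>h>b. \<Phi> h v = 0"
  shows "mode_sum x v = (\<Sum>m=a..b. smul (x m) (\<Phi> m v))"
  unfolding mode_sum_def
proof (rule Sum_any.expand_superset)
  show "{m. smul (x m) (\<Phi> m v) \<noteq> 0} \<subseteq> {a..b}"
  proof
    fix m assume "m \<in> {m. smul (x m) (\<Phi> m v) \<noteq> 0}"
    then have "\<not> m < a" "\<not> m > b"
      using x v unfolding vanishes_below_def by auto
    then show "m \<in> {a..b}" by auto
  qed
qed simp

lemma mode_sum_add: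
  assumes x: "vanishes_below a x"
  shows "mode_sum x (v + w) = mode_sum x v + mode_sum x w"
proof -
  obtain b where b: "\<forall>h>b. \<Phi> h v = 0" "\<forall>h>b. \<Phi> h w = 0"
    using annihilated_finite[of "{v, w}" 0] by auto
  then have vw: "\<forall>h>b. \<Phi> h (v + w) = 0" by (simp add: Phi_add)
  show ?thesis
    unfolding mode_sum_eq_sum[OF x b(1)] mode_sum_eq_sum[OF x b(2)] mode_sum_eq_sum[OF x vw]
    by (simp add: Phi_add scale_right_distrib sum.distrib)
qed

lemma mode_sum_scale:
  assumes x: "vanishes_below a x"
  shows "mode_sum x (smul c v) = smul c (mode_sum x v)"
proof -
  obtain b where b: "\<forall>h>b. \<Phi> h v = 0" using annihilated by blast
  then have cv: "\<forall>h>b. \<Phi> h (smul c v) = 0" by (simp add: Phi_scale)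
  show ?thesis
    unfolding mode_sum_eq_sum[OF x b] mode_sum_eq_sum[OF x cv]
    by (simp add: Phi_scale scale_sum_right mult.commute)
qed

lemma mode_sum_zero: "vanishes_below a x \<Longrightarrow> mode_sum x 0 = 0"
  using mode_sum_scale[of a x 0 0] by simp

lemma mode_sum_sum:
  "vanishes_below a x \<Longrightarrow> mode_sum x (\<Sum>k\<in>A. f k) = (\<Sum>k\<in>A. mode_sum x (f k))"
  by (induction A rule: infinite_finite_induct) (auto simp: mode_sum_zero mode_sum_add)

lemma mode_sum_linear:
  assumes "vanishes_below a x" "vanishes_below a y"
  shows "mode_sum (\<lambda>m. x m + c * y m) v = mode_sum x v + smul c (mode_sum y v)"
proof -
  obtain b where b: "\<forall>h>b. \<Phi> h v = 0" using annihilated by blast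
  show ?thesis
    unfolding mode_sum_eq_sum[OF assms(1) b] mode_sum_eq_sum[OF assms(2) b]
      mode_sum_eq_sum[OF vanishes_below_linear[OF assms] b]
    by (simp add: scale_left_distrib sum.distrib scale_sum_right)
qed

lemma mode_sum_delta: "mode_sum (delta j) v = \<Phi> j v"
proof -
  have "mode_sum (delta j) v = Sum_any (\<lambda>m. if m = j then \<Phi> m v else 0)"
    unfolding mode_sum_def delta_def by (rule Sum_any.cong) auto
  then show ?thesis by simp
qed

lemma mode_sum_Phi:
  assumes x: "vanishes_below a x"
  shows "mode_sum x (\<Phi> k v) + \<Phi> k (mode_sum x v) = smul (- ((-1) powi k) * x (- k)) v"
proof -
  obtain b where b: "\<forall>h>b. \<Phi> h v = 0" "\<forall>h>b. \<Phi> h (\<Phi> k v) = 0" "\<bar>k\<bar> \<le> b"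
    using annihilated_finite[of "{v, \<Phi> k v}" "\<bar>k\<bar>"] by auto
  have "mode_sum x (\<Phi> k v) + \<Phi> k (mode_sum x v)
      = (\<Sum>m=a..b. smul (x m) (\<Phi> m (\<Phi> k v) + \<Phi> k (\<Phi> m v)))"
    unfolding mode_sum_eq_sum[OF x b(1)] mode_sum_eq_sum[OF x b(2)]
    by (simp add: Phi_sum Phi_scale scale_right_distrib sum.distrib)
  also have "\<dots> = (\<Sum>m=a..b. if m = - k then smul (- ((-1) powi k) * x (- k)) v else 0)"
    unfolding clifford by (intro sum.cong) (auto simp: power_int_minus_one_minus)
  also have "\<dots> = smul (- ((-1) powi k) * x (- k)) v"
    using x b(3) by (auto simp: vanishes_below_def)
  finally show ?thesis .
qed

lemma mode_sum_anticommutator: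
  assumes x: "vanishes_below a x" and y: "vanishes_below b y"
  shows "mode_sum x (mode_sum y v) + mode_sum y (mode_sum x v) = smul (- pairing x y) v"
proof -
  obtain c where c: "\<forall>h>c. \<Phi> h v = 0" "\<forall>h>c. \<Phi> h (mode_sum x v) = 0" "- a \<le> c"
    using annihilated_finite[of "{v, mode_sum x v}" "- a"] by auto
  have "mode_sum x (mode_sum y v) + mode_sum y (mode_sum x v)
      = (\<Sum>k=b..c. smul (y k) (mode_sum x (\<Phi> k v) + \<Phi> k (mode_sum x v)))"
    unfolding mode_sum_eq_sum[OF y c(1)] mode_sum_eq_sum[OF y c(2)]
    by (simp add: mode_sum_sum[OF x] mode_sum_scale[OF x] scale_right_distrib sum.distrib)
  also have "\<dots> = smul (\<Sum>k=b..c. - ((-1) powi k * x (- k) * y k)) v"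
    unfolding mode_sum_Phi[OF x] scale_sum_left by (intro sum.cong) (auto simp: mult_ac)
  also have "(\<Sum>k=b..c. - ((-1) powi k * x (- k) * y k)) = - pairing x y"
    unfolding sum_negf using pairing_eq_sum[OF x y, of b c] c(3) by simp
  finally show ?thesis .
qed

text \<open>Elimination from the lowest mode: subtracting \<open>y\<close> raises the lower bound
  \<open>a\<close> by one and keeps orthogonality to \<open>xi\<close>. It ends when
  \<open>a\<close> exceeds \<open>N\<close>, beyond which all modes kill \<open>u\<close>.\<close>

lemma mode_sum_invariant:
  assumes U: "subspace U" and u: "u \<in> U" and xi: "vanishes_below b xi"
    and step: "\<And>a x. vanishes_below a x \<Longrightarrow> pairing x xi = 0 \<Longrightarrow>
      \<exists>y. vanishes_below a y \<and> pairing y xi = 0 \<and> (\<forall>u\<in>U. mode_sum y u \<in> U) \<and> y a = x a"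
    and x: "vanishes_below a x" "pairing x xi = 0"
  shows "mode_sum x u \<in> U"
proof -
  obtain N where N: "\<forall>h>N. \<Phi> h u = 0" using annihilated by blast
  show ?thesis using x
  proof (induction "nat (N + 1 - a)" arbitrary: a x)
    case 0
    then show ?case
      using mode_sum_eq_sum[OF _ N, of a x] U by (simp add: subspace_0)
  next
    case (Suc n)
    obtain y where y: "vanishes_below a y" "pairing y xi = 0" "\<forall>u\<in>U. mode_sum y u \<in> U" "y a = x a"
      using step[OF Suc.prems] by blast
    let ?z = "\<lambda>m. x m + (- 1) * y m"
    have "vanishes_below (a + 1) ?z"
      unfolding vanishes_below_def
    proof (intro allI impI)
      fix m assume "m < a + 1"
      then have "m < a \<or> m = a" by linarith
      then show "x m + (- 1) * y m = 0"
        using y(1,4) Suc.prems(1) by (auto simp: vanishes_below_def)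
    qed
    moreover have "pairing ?z xi = 0"
      using pairing_linear_left[OF Suc.prems(1) y(1) xi, of "- 1"] Suc.prems(2) y(2) by simp
    moreover have "n = nat (N + 1 - (a + 1))" using Suc.hyps(2) by linarith
    ultimately have z: "mode_sum ?z u \<in> U" using Suc.hyps(1) by blast
    have "mode_sum x u = mode_sum ?z u + mode_sum y u"
      unfolding mode_sum_linear[OF Suc.prems(1) y(1)] by simp
    then show ?case using subspace_add[OF U z, of "mode_sum y u"] u y(3) by simp
  qed
qed

text \<open>With X = \<open>mode_sum xi\<close>, isotropy means X^2 = 0, so the kernel contains the
  image of X; combinations orthogonal to \<open>xi\<close> anticommute with X and preserve the
  kernel.\<close>

lemma isotropic_kernel:
  assumes xi: "vanishes_below b xi" "xi j \<noteq> 0" "pairing xi xi = 0"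
  defines "U \<equiv> {v. mode_sum xi v = 0}"
  shows "subspace U" "U \<noteq> {0}" "U \<noteq> UNIV"
    "\<And>a x u. vanishes_below a x \<Longrightarrow> pairing x xi = 0 \<Longrightarrow> u \<in> U \<Longrightarrow> mode_sum x u \<in> U"
proof -
  show "subspace U"
    unfolding U_def by (rule subspaceI)
      (auto simp: mode_sum_zero[OF xi(1)] mode_sum_add[OF xi(1)] mode_sum_scale[OF xi(1)])
  show proper: "U \<noteq> UNIV"
  proof
    assume "U = UNIV"
    then have "vac \<in> U" "\<Phi> (- j) vac \<in> U" by simp_all
    then have "mode_sum xi vac = 0" "mode_sum xi (\<Phi> (- j) vac) = 0" by (simp_all add: U_def)
    \<comment> \<open>If X killed both vectors, so would its anticommutator with
      \<open>\<Phi> (- j)\<close> kill \<open>vac\<close>, but that is a nonzero multiple of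
      \<open>xi j\<close>.\<close>
    then have "smul (- ((-1) powi (- j)) * xi j) vac = 0"
      using mode_sum_Phi[OF xi(1), of "- j" vac] by (simp only: Phi_zero minus_minus add_0)
    moreover have "- ((-1) powi (- j)) * xi j \<noteq> 0" using xi(2) by simp
    ultimately show False using vac_nonzero by (simp only: scale_eq_0_iff simp_thms)
  qed
  show "U \<noteq> {0}"
  proof
    assume U0: "U = {0}"
    have "mode_sum xi (mode_sum xi v) = 0" for v
      by (rule self_double_eq_0) (use mode_sum_anticommutator[OF xi(1) xi(1), of v] xi(3) in simp)
    then have "mode_sum xi v \<in> U" for v by (simp add: U_def)
    then have "mode_sum xi v = 0" for v unfolding U0 by simp
    then have "U = UNIV" by (simp add: U_def)
    with proper show False ..
  qed
  show "mode_sum x u \<in> U" if "vanishes_below a x" "pairing x xi = 0" "u \<in> U" for a x u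
  proof -
    have "mode_sum xi u = 0" using that(3) by (simp only: U_def mem_Collect_eq)
    then have "mode_sum xi (mode_sum x u) = 0"
      using mode_sum_anticommutator[OF that(1) xi(1), of u] mode_sum_zero[OF that(1)] that(2)
      by (simp only: minus_zero scale_zero_left add_0)
    then show ?thesis by (simp only: U_def mem_Collect_eq)
  qed
qed

text \<open>Both U + X U and the part of U that X maps into U are Clifford-invariant, so for proper
  U irreducibility makes the sum total and direct; the twisted image of \<open>vac\<close> then
  gives the contradiction.\<close>

lemma anisotropic_irreducible:
  assumes xi: "vanishes_below b xi" and ne: "pairing xi xi \<noteq> 0" and U: "subspace U"
    and inv: "\<And>a x u. vanishes_below a x \<Longrightarrow> pairing x xi = 0 \<Longrightarrow> u \<in> U \<Longrightarrow> mode_sum x u \<in> U"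
  shows "U = {0} \<or> U = UNIV"
proof (rule ccontr)
  assume proper: "\<not> (U = {0} \<or> U = UNIV)"
  let ?X = "mode_sum xi"
  \<comment> \<open>The anticommutator of X with itself is 2 X^2, so \<open>\<kappa>\<close> is the
    scalar X^2.\<close>
  define \<kappa> where "\<kappa> = - pairing xi xi / 2"
  have \<kappa>: "\<kappa> \<noteq> 0" using ne by (simp add: \<kappa>_def)
  note X_add = mode_sum_add[OF xi] and X_scale = mode_sum_scale[OF xi] and X_zero = mode_sum_zero[OF xi]
  have X_minus: "?X (- v) = - ?X v" for v using X_scale[of "- 1" v] by simp
  have XX: "?X (?X v) = smul \<kappa> v" for v
  proof -
    have "smul 2 (?X (?X v)) = smul (- pairing xi xi) v"
      unfolding scale_two by (rule mode_sum_anticommutator[OF xi xi])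
    then have "smul (1/2) (smul 2 (?X (?X v))) = smul (1/2) (smul (- pairing xi xi) v)"
      by (rule arg_cong)
    then show ?thesis by (simp add: \<kappa>_def)
  qed
  \<comment> \<open>Orthogonal projection: \<open>\<psi> j\<close> is \<open>delta j\<close> minus
    its component along \<open>xi\<close>. Hence \<open>\<Psi> j\<close> preserves \<open>U\<close>
    and anticommutes with X.\<close>
  define \<gamma> where "\<gamma> j = pairing (delta j) xi / pairing xi xi" for j
  define \<psi> where "\<psi> j = (\<lambda>m. delta j m + (- \<gamma> j) * xi m)" for j
  define \<Psi> where "\<Psi> j = mode_sum (\<psi> j)" for j
  have van: "vanishes_below (min j b) (delta j)" "vanishes_below (min j b) xi" for j
    using vanishes_below_mono[OF vanishes_below_delta] vanishes_below_mono[OF xi] by auto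
  have \<psi>: "vanishes_below (min j b) (\<psi> j)" "pairing (\<psi> j) xi = 0" for j
    unfolding \<psi>_def pairing_linear_left[OF van xi] \<gamma>_def
    by (rule vanishes_below_linear[OF van]) (use ne in simp)
  have \<Psi>_U: "\<Psi> j u \<in> U" if "u \<in> U" for j u
    unfolding \<Psi>_def by (rule inv[OF \<psi> that])
  note \<Psi>_scale = mode_sum_scale[OF \<psi>(1), folded \<Psi>_def] and \<Psi>_add = mode_sum_add[OF \<psi>(1), folded \<Psi>_def]
  have \<Psi>_minus: "\<Psi> j (- v) = - \<Psi> j v" for j v using \<Psi>_scale[of j "- 1" v] by simp
  have \<Psi>X: "\<Psi> j (?X v) = - ?X (\<Psi> j v)" for j v
    using mode_sum_anticommutator[OF \<psi>(1) xi, of j v] \<psi>(2)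
    by (simp add: \<Psi>_def eq_neg_iff_add_eq_0)
  have Phi_eq: "\<Phi> j v = \<Psi> j v + smul (\<gamma> j) (?X v)" for j v
    using mode_sum_linear[OF van, of j "- \<gamma> j" v] by (simp add: \<Psi>_def \<psi>_def mode_sum_delta)
  have Phi_split: "\<Phi> j (u + ?X w)
      = (\<Psi> j u + smul (\<gamma> j * \<kappa>) w) + ?X (smul (\<gamma> j) u - \<Psi> j w)" for j u w
  proof -
    have "?X (smul (\<gamma> j) u - \<Psi> j w) = smul (\<gamma> j) (?X u) - ?X (\<Psi> j w)"
      using X_add[of "smul (\<gamma> j) u" "- \<Psi> j w"] by (simp add: X_scale X_minus)
    then show ?thesis
      by (simp add: Phi_eq \<Psi>_add X_add XX \<Psi>X scale_right_distrib algebra_simps)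
  qed
  let ?S = "{u + ?X w | u w. u \<in> U \<and> w \<in> U}"
  have "?S = {0} \<or> ?S = UNIV"
  proof (rule irreducible)
    show "subspace ?S"
    proof (rule subspaceI)
      have "0 = 0 + ?X 0" by (simp add: X_zero)
      then show "0 \<in> ?S" using subspace_0[OF U] by blast
      fix x assume "x \<in> ?S"
      then obtain u w where x: "x = u + ?X w" "u \<in> U" "w \<in> U" by blast
      have "smul c x = smul c u + ?X (smul c w)" for c
        by (simp add: x X_scale scale_right_distrib)
      then show "smul c x \<in> ?S" for c using x subspace_scale[OF U] by blast
      fix y assume "y \<in> ?S"
      then obtain u' w' where y: "y = u' + ?X w'" "u' \<in> U" "w' \<in> U" by blast
      have "x + y = (u + u') + ?X (w + w')" by (simp add: x y X_add)
      then show "x + y \<in> ?S" using x y subspace_add[OF U] by blast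
    qed
    show "\<Phi> h s \<in> ?S" if "s \<in> ?S" for h s
    proof -
      from that obtain u w where s: "s = u + ?X w" "u \<in> U" "w \<in> U" by blast
      have "\<Psi> h u + smul (\<gamma> h * \<kappa>) w \<in> U" "smul (\<gamma> h) u - \<Psi> h w \<in> U"
        by (intro subspace_diff[OF U] subspace_add[OF U] subspace_scale[OF U] \<Psi>_U s)+
      then show ?thesis unfolding s(1) Phi_split by blast
    qed
  qed
  moreover have "U \<subseteq> ?S"
  proof
    fix u assume "u \<in> U"
    moreover have "u = u + ?X 0" by (simp add: X_zero)
    ultimately show "u \<in> ?S" using subspace_0[OF U] by blast
  qed
  moreover have "0 \<in> U" by (rule subspace_0[OF U])
  ultimately have "?S = UNIV" using proper by blast
  then obtain u w where vac: "vac = u + ?X w" and uw: "u \<in> U" "w \<in> U" by blast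
  \<comment> \<open>X maps this subspace to itself because X^2 is a scalar. Its vanishing makes the
    sum of U and X U direct.\<close>
  let ?I = "{v \<in> U. ?X v \<in> U}"
  have "?I = {0} \<or> ?I = UNIV"
  proof (rule irreducible)
    show "subspace ?I"
      by (rule subspaceI) (simp_all add: X_zero X_add X_scale subspace_0[OF U] subspace_add[OF U] subspace_scale[OF U])
    show "\<Phi> h v \<in> ?I" if "v \<in> ?I" for h v
    proof -
      have v: "v \<in> U" "?X v \<in> U" using that by simp_all
      have "?X (\<Phi> h v) = smul (\<gamma> h * \<kappa>) v - \<Psi> h (?X v)"
      proof -
        have "?X (\<Phi> h v) = ?X (\<Psi> h v) + smul (\<gamma> h) (smul \<kappa> v)"
          unfolding Phi_eq[of h v] by (simp only: X_add X_scale XX)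
        then show ?thesis by (simp only: \<Psi>X scale_scale diff_minus_eq_add add.commute)
      qed
      moreover have "smul (\<gamma> h * \<kappa>) v - \<Psi> h (?X v) \<in> U"
        by (rule subspace_diff[OF U subspace_scale[OF U v(1)] \<Psi>_U[OF v(2)]])
      moreover have "\<Phi> h v \<in> U"
        by (subst Phi_eq) (rule subspace_add[OF U \<Psi>_U[OF v(1)] subspace_scale[OF U v(2)]])
      ultimately show ?thesis by (simp only: mem_Collect_eq)
    qed
  qed
  then have I: "?I = {0}" using proper by blast
  have unique: "p = 0 \<and> q = 0" if "p \<in> U" "q \<in> U" "p + ?X q = 0" for p q
  proof -
    have "?X q = - p" using that(3) by (simp add: eq_neg_iff_add_eq_0 add.commute)
    then have "q \<in> ?I" using that subspace_neg[OF U] by simp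
    then have "q = 0" using I by blast
    then show ?thesis using that(3) by (simp add: X_zero)
  qed
  \<comment> \<open>The image of \<open>vac\<close> under
    \<open>u + X w \<mapsto> X u - \<kappa> w\<close>, the map that anticommutes with all
    modes.\<close>
  define n where "n = ?X u - smul \<kappa> w"
  have "n = 0"
  proof (rule no_opposite_vacuum)
    fix h :: int assume h: "h \<ge> 0"
    define e where "e = (if h = 0 then eps else 0)"
    have Xsub: "?X (v - v') = ?X v - ?X v'" for v v'
      using X_add[of v "- v'"] by (simp add: X_minus)
    \<comment> \<open>The equation for \<open>\<Phi> h vac\<close> is split into its components in U
      and X U.\<close>
    have "(\<Psi> h u + smul (\<gamma> h * \<kappa>) w - smul e u) + ?X (smul (\<gamma> h) u - \<Psi> h w - smul e w) = 0"
      using Phi_vac[OF h, folded e_def] unfolding vac Phi_split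
      by (simp add: Xsub X_add X_scale scale_right_distrib algebra_simps)
    then have "\<Psi> h u + smul (\<gamma> h * \<kappa>) w - smul e u = 0 \<and> smul (\<gamma> h) u - \<Psi> h w - smul e w = 0"
      by (intro unique subspace_diff[OF U] subspace_add[OF U] subspace_scale[OF U] \<Psi>_U uw)
    then have 1: "\<Psi> h u = smul e u - smul (\<gamma> h * \<kappa>) w" and 2: "\<Psi> h w = smul (\<gamma> h) u - smul e w"
      by (auto simp: algebra_simps)
    have "\<Phi> h n = \<Phi> h (smul (- \<kappa>) w + ?X u)" by (simp add: n_def)
    also have "\<dots> = smul (- e) n"
      unfolding Phi_split \<Psi>_scale 1 2 n_def
      by (simp add: Xsub X_add X_scale X_minus scale_right_diff_distrib algebra_simps)
    finally show "\<Phi> h n = smul (- (if h = 0 then eps else 0)) n" by (simp add: e_def)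
  qed
  then have "?X u = smul \<kappa> w" by (simp add: n_def)
  then have "u \<in> ?I" using uw subspace_scale[OF U] by simp
  then have "u = 0" using I by blast
  moreover have "w = 0" using \<open>?X u = smul \<kappa> w\<close> \<open>u = 0\<close> \<kappa> by (simp add: X_zero)
  ultimately have "vac = 0" using vac by (simp add: X_zero)
  then show False using vac_nonzero by blast
qed

end

subsection \<open>The action of the superalgebra\<close>

definition G_coeff :: "complex fls \<Rightarrow> int \<Rightarrow> int \<Rightarrow> complex" where
  "G_coeff chi h = (\<lambda>m. chi_coeff chi (h - m) + (- (of_int h / 2 + 1/2)) * delta h m)"

text \<open>For even \<open>n\<close> the sign separates integral from non-integral powers, so this
  is a coefficient of (\<chi>^(1))^2 - (\<chi>^(2))^2.\<close>

definition chi_conv :: "complex fls \<Rightarrow> int \<Rightarrow> complex" where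
  "chi_conv chi n = Sum_any (\<lambda>k. (-1) powi k * chi_coeff chi k * chi_coeff chi (n - k))"

lemma vanishes_below_chi:
  "\<forall>k>p. chi_coeff chi k = 0 \<Longrightarrow> vanishes_below (h - p) (\<lambda>m. chi_coeff chi (h - m))"
  by (auto simp: vanishes_below_def)

lemma vanishes_below_G_coeff:
  assumes "\<forall>k>p. chi_coeff chi k = 0" "p \<ge> 0"
  shows "vanishes_below (h - p) (G_coeff chi h)"
  unfolding G_coeff_def
  by (rule vanishes_below_linear[OF vanishes_below_chi vanishes_below_mono[OF vanishes_below_delta]])
    (use assms in auto)

lemma chi_conv_eq_sum:
  assumes "\<forall>k>p. chi_coeff chi k = 0"
  shows "chi_conv chi n = (\<Sum>k=n-p..p. (-1) powi k * chi_coeff chi k * chi_coeff chi (n - k))"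
  unfolding chi_conv_def
proof (rule Sum_any.expand_superset)
  show "{k. (-1) powi k * chi_coeff chi k * chi_coeff chi (n - k) \<noteq> 0} \<subseteq> {n - p..p}"
  proof
    fix k assume "k \<in> {k. (-1) powi k * chi_coeff chi k * chi_coeff chi (n - k) \<noteq> 0}"
    then have "\<not> k > p" "\<not> n - k > p" using assms by auto
    then show "k \<in> {n - p..p}" by auto
  qed
qed simp

lemma minus_one_powi_diff: "(-1 :: complex) powi (h - j) = (-1) powi h * (-1) powi j"
  by (simp add: power_int_minus_left)

text \<open>The reflection \<open>k \<mapsto> n - k\<close> reverses the sign of every term.\<close>

lemma chi_conv_odd:
  assumes "\<forall>k>p. chi_coeff chi k = 0" "odd n"
  shows "chi_conv chi n = 0"
proof -
  have "chi_conv chi n = (\<Sum>k=n-p..p. - ((-1) powi k * chi_coeff chi k * chi_coeff chi (n - k)))"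
    unfolding chi_conv_eq_sum[OF assms(1)]
    by (rule sum.reindex_bij_witness[of _ "\<lambda>k. n - k" "\<lambda>k. n - k"])
      (use assms(2) in \<open>auto simp: minus_one_powi_diff power_int_minus_left\<close>)
  also have "\<dots> = - chi_conv chi n"
    unfolding chi_conv_eq_sum[OF assms(1)] by (rule sum_negf)
  finally show ?thesis by simp
qed

lemma pairing_G_coeff:
  assumes "\<forall>k>p. chi_coeff chi k = 0" "p \<ge> 0"
  shows "pairing (G_coeff chi k) (G_coeff chi h) = (-1) powi h * chi_conv chi (h + k)
    - (of_int h / 2 + 1/2) * (-1) powi h * chi_coeff chi (h + k)
    - (of_int k / 2 + 1/2) * (-1) powi k * chi_coeff chi (h + k)
    + (if h + k = 0 then (of_int h / 2 + 1/2) * (of_int k / 2 + 1/2) * (-1) powi h else 0)"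
proof -
  let ?x = "\<lambda>h m. chi_coeff chi (h - m)"
  have x: "vanishes_below (h - p) (?x h)" for h by (rule vanishes_below_chi[OF assms(1)])
  have d: "vanishes_below (h - p) (delta h)" for h
    by (rule vanishes_below_mono[OF vanishes_below_delta]) (use assms(2) in simp)
  have "pairing (?x k) (?x h) = (\<Sum>m=h-p..p-k. (-1) powi m * ?x k (- m) * ?x h m)"
    by (rule pairing_eq_sum[OF x x]) auto
  also have "\<dots> = (\<Sum>j=h+k-p..p. (-1) powi h * ((-1) powi j * chi_coeff chi j * chi_coeff chi (h + k - j)))"
    by (rule sum.reindex_bij_witness[of _ "\<lambda>j. h - j" "\<lambda>m. h - m"])
      (auto simp: minus_one_powi_diff algebra_simps)
  also have "\<dots> = (-1) powi h * chi_conv chi (h + k)"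
    unfolding chi_conv_eq_sum[OF assms(1)] by (rule sum_distrib_left[symmetric])
  finally have xx: "pairing (?x k) (?x h) = (-1) powi h * chi_conv chi (h + k)" .
  show ?thesis
    unfolding G_coeff_def pairing_linear_right[OF vanishes_below_linear[OF x d] x d]
      pairing_linear_left[OF x d x] pairing_linear_left[OF x d d] xx pairing_delta_right pairing_delta_left
    by (auto simp: delta_def field_simps)
qed

lemma sum_keys_single:
  "(\<Sum>z\<in>Poly_Mapping.keys (Poly_Mapping.single a \<alpha>). g (Poly_Mapping.lookup (Poly_Mapping.single a \<alpha>) z) z) = g \<alpha> a"
  if "\<And>z. g 0 z = (0 :: 'b::comm_monoid_add)"
  using that by simp

text \<open>A zero coefficient removes its key from the sum, which is harmless since
  \<open>g 0 z = 0\<close>.\<close>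

lemma sum_keys_single_plus_single:
  fixes a b :: 'a and \<alpha> \<beta> :: complex and g :: "complex \<Rightarrow> 'a \<Rightarrow> 'b::comm_monoid_add"
  assumes "a \<noteq> b" and g: "\<And>z. g 0 z = 0"
  defines "q \<equiv> Poly_Mapping.single a \<alpha> + Poly_Mapping.single b \<beta>"
  shows "(\<Sum>z\<in>Poly_Mapping.keys q. g (Poly_Mapping.lookup q z) z) = g \<alpha> a + g \<beta> b"
proof -
  have l: "Poly_Mapping.lookup q z = (if z = a then \<alpha> else if z = b then \<beta> else 0)" for z
    using assms(1) by (simp add: q_def lookup_add lookup_single when_def)
  have "Poly_Mapping.keys q \<subseteq> {a, b}"
    by (auto simp: in_keys_iff l split: if_splits)
  then have "(\<Sum>z\<in>Poly_Mapping.keys q. g (Poly_Mapping.lookup q z) z) = (\<Sum>z\<in>{a, b}. g (Poly_Mapping.lookup q z) z)"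
    by (intro sum.mono_neutral_left) (auto simp: in_keys_iff g)
  then show ?thesis using assms(1) by (simp add: l)
qed

text \<open>The coefficients of the operator \<open>X\<close>, for \<open>L = 2\<ell>\<close>.\<close>

definition null_mode :: "int \<Rightarrow> complex fps \<Rightarrow> int \<Rightarrow> complex" where
  "null_mode L g m = (if m < - L then 0 else (-1) powi m * g $ nat (L + m))"

text \<open>This is \<open>z \<chi>(z) - \<chi>\<^sub>0\<close> as a series in \<open>z\<^bsup>1/2\<^esup>\<close> for \<open>p = 0\<close>.\<close>

definition chi_fps :: "complex fls \<Rightarrow> complex fps" where
  "chi_fps chi = Abs_fps (\<lambda>n. if n = 0 then 0 else chi_coeff chi (- int n))"

lemma vanishes_below_null_mode: "vanishes_below (- L) (null_mode L g)"
  by (simp add: vanishes_below_def null_mode_def)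

lemma G_coeff_diag: "G_coeff chi h h = chi_coeff chi 0 - (of_int h + 1) / 2"
  by (simp add: G_coeff_def delta_def field_simps)

text \<open>For \<open>N = L - h \<ge> 0\<close> the pairing is coefficient \<open>N\<close> of
  \<open>g * chi_fps chi\<close> plus half of \<theta> g, which the equation for \<open>g\<close>
  makes zero.\<close>

lemma pairing_G_coeff_null_mode:
  assumes expansion: "\<forall>k>0. chi_coeff chi k = 0"
    and chi0: "chi_coeff chi 0 = (of_int L + 1) / 2"
    and g: "fps_X * fps_deriv g = - 2 * chi_fps chi * g"
  shows "pairing (G_coeff chi h) (null_mode L g) = 0"
proof -
  have Gv: "vanishes_below h (G_coeff chi h)"
    using vanishes_below_G_coeff[OF expansion, of h] by simp
  have sum: "pairing (G_coeff chi h) (null_mode L g)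
      = (\<Sum>m=-L..-h. (-1) powi m * G_coeff chi h (- m) * null_mode L g m)"
    by (rule pairing_eq_sum[OF Gv vanishes_below_null_mode]) auto
  show ?thesis
  proof (cases "L < h")
    case True
    then show ?thesis by (simp add: sum)
  next
    case False
    define N where "N = nat (L - h)"
    have h: "h = L - int N" using False by (simp add: N_def)
    \<comment> \<open>The sign in \<open>null_mode\<close> cancels the one in
      \<open>pairing\<close>, so an ordinary convolution remains.\<close>
    have "pairing (G_coeff chi h) (null_mode L g) = (\<Sum>j=0..N. g $ j * G_coeff chi h (L - int j))"
      unfolding sum
      by (rule sum.reindex_bij_witness[of _ "\<lambda>j. int j - L" "\<lambda>m. nat (L + m)"])
        (auto simp: null_mode_def h)
    also have "\<dots> = (\<Sum>j=0..N. g $ j * chi_fps chi $ (N - j) + (if j = N then of_nat N / 2 * g $ N else 0))"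
    proof (rule sum.cong[OF refl])
      fix j assume j: "j \<in> {0..N}"
      show "g $ j * G_coeff chi h (L - int j)
          = g $ j * chi_fps chi $ (N - j) + (if j = N then of_nat N / 2 * g $ N else 0)"
      proof (cases "j = N")
        case True
        then have "G_coeff chi h (L - int j) = of_nat N / 2"
          using G_coeff_diag[of chi h] by (simp add: h chi0 field_simps)
        then show ?thesis using True by (simp add: chi_fps_def)
      next
        case False
        then have "G_coeff chi h (L - int j) = chi_fps chi $ (N - j)"
          using j by (simp add: G_coeff_def delta_def chi_fps_def h of_nat_diff)
        then show ?thesis using False by simp
      qed
    qed
    also have "\<dots> = (g * chi_fps chi) $ N + of_nat N / 2 * g $ N"
      by (simp add: sum.distrib fps_mult_nth)
    also have "\<dots> = 0"
    proof -
      have "of_nat N * g $ N = (fps_const (- 2) * (g * chi_fps chi)) $ N"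
        by (simp flip: fps_X_deriv_nth add: g numeral_fps_const mult_ac del: fps_mult_left_const_nth)
      also have "\<dots> = - 2 * (g * chi_fps chi) $ N" by (rule fps_mult_left_const_nth)
      finally have "of_nat N / 2 * g $ N = - (g * chi_fps chi) $ N"
        by (simp only: times_divide_eq_left) simp
      then show ?thesis by (simp only:) simp
    qed
    finally show ?thesis .
  qed
qed

text \<open>With \<open>j = L + m\<close> the three signs leave
  \<open>(-1)^m = (-1)^L (-1)^(2 L - j)\<close>, which turns one factor into g(-X). For
  \<open>L < 0\<close> the range of summation is empty.\<close>

lemma pairing_null_mode_self:
  "pairing (null_mode L g) (null_mode L g)
    = (if L < 0 then 0 else (-1) powi L * (g * (g oo - fps_X)) $ (2 * nat L))"
proof -
  have sum: "pairing (null_mode L g) (null_mode L g)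
      = (\<Sum>m=-L..L. (-1) powi m * null_mode L g (- m) * null_mode L g m)"
    by (rule pairing_eq_sum[OF vanishes_below_null_mode vanishes_below_null_mode]) auto
  show ?thesis
  proof (cases "L < 0")
    case True
    then show ?thesis by (simp add: sum)
  next
    case False
    define l where "l = nat L"
    have L: "L = int l" using False by (simp add: l_def)
    have "pairing (null_mode L g) (null_mode L g)
        = (\<Sum>j=0..2 * l. (-1) powi L * (g $ j * ((-1) ^ (2 * l - j) * g $ (2 * l - j))))"
      unfolding sum
    proof (rule sum.reindex_bij_witness[of _ "\<lambda>j. int j - L" "\<lambda>m. nat (L + m)"])
      fix m assume m: "m \<in> {- L..L}"
      have 1: "nat (L - m) = 2 * l - nat (L + m)" using m unfolding L by (simp only: atLeastAtMost_iff) arith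
      have 2: "(-1 :: complex) ^ nat (L - m) = (-1) powi (L - m)"
        using m by (simp add: power_int_def)
      show "(-1) powi L * (g $ nat (L + m) * ((-1) ^ (2 * l - nat (L + m)) * g $ (2 * l - nat (L + m))))
          = (-1) powi m * null_mode L g (- m) * null_mode L g m"
        unfolding 1[symmetric] 2 using m
        by (simp add: null_mode_def minus_one_powi_diff power_int_minus_one_minus mult_ac)
    qed (auto simp: L)
    also have "\<dots> = (-1) powi L * (g * (g oo - fps_X)) $ (2 * l)"
      by (simp add: fps_mult_nth fps_compose_uminus' sum_distrib_left)
    finally show ?thesis using False by (simp add: l_def)
  qed
qed

section \<open>The module structure and its invariant subspaces\<close>

context twisted_fock
begin

lemma mode_sum_cmult:
  assumes "vanishes_below a x"
  shows "mode_sum (\<lambda>m. c * x m) v = smul c (mode_sum x v)"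
proof -
  obtain b where b: "\<forall>h>b. \<Phi> h v = 0" using annihilated by blast
  have "vanishes_below a (\<lambda>m. c * x m)" using assms by (simp add: vanishes_below_def)
  from mode_sum_eq_sum[OF this b] mode_sum_eq_sum[OF assms b]
  show ?thesis by (simp add: scale_sum_right)
qed

lemma F_chi_GG:
  assumes "\<forall>k>p. chi_coeff chi k = 0" "p \<ge> 0"
  shows "F_chi smul \<Phi> chi (GG h) v = mode_sum (G_coeff chi h) v"
proof -
  have "Sum_any (\<lambda>k. smul (chi_coeff chi k) (\<Phi> (h - k) v)) = mode_sum (\<lambda>m. chi_coeff chi (h - m)) v"
    unfolding mode_sum_def
  proof (rule Sum_any.reindex_cong[of "\<lambda>m. h - m"])
    show "bij (\<lambda>m. h - m)" by (rule bij_betw_byWitness[of _ "\<lambda>m. h - m"]) auto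
  qed (simp add: o_def)
  moreover have "mode_sum (G_coeff chi h) v
      = mode_sum (\<lambda>m. chi_coeff chi (h - m)) v + smul (- (of_int h / 2 + 1/2)) (\<Phi> h v)"
    unfolding G_coeff_def
    by (subst mode_sum_linear[OF vanishes_below_chi[OF assms(1)] vanishes_below_mono[OF vanishes_below_delta]])
      (use assms(2) in \<open>simp_all add: mode_sum_delta\<close>)
  ultimately show ?thesis by (simp add: add.commute)
qed

lemma F_chi_even: "\<not> Atw_odd x \<Longrightarrow> \<exists>c. \<forall>v. F_chi smul \<Phi> chi x v = smul c v"
proof (cases x)
  case (SS n)
  then show ?thesis by (simp only:) (rule exI, rule allI, rule F_chi.simps(2))
next
  case (TT n)
  then show ?thesis by (simp only:) (rule exI, rule allI, rule F_chi.simps(3))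
next
  case CC
  then show ?thesis by (simp only:) (rule exI, rule allI, rule F_chi.simps(4))
qed simp

lemma F_chi_linear:
  assumes "\<forall>k>p. chi_coeff chi k = 0" "p \<ge> 0"
  shows "F_chi smul \<Phi> chi x (v + w) = F_chi smul \<Phi> chi x v + F_chi smul \<Phi> chi x w"
    and "F_chi smul \<Phi> chi x (smul c v) = smul c (F_chi smul \<Phi> chi x v)"
proof -
  note G = vanishes_below_G_coeff[OF assms]
  show "F_chi smul \<Phi> chi x (v + w) = F_chi smul \<Phi> chi x v + F_chi smul \<Phi> chi x w"
  proof (cases "Atw_odd x")
    case True
    then obtain h where "x = GG h" by (cases x) auto
    then show ?thesis by (simp only: F_chi_GG[OF assms] mode_sum_add[OF G])
  next
    case False
    then obtain d where "\<forall>v. F_chi smul \<Phi> chi x v = smul d v" using F_chi_even by blast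
    then show ?thesis by (simp only: scale_right_distrib)
  qed
  show "F_chi smul \<Phi> chi x (smul c v) = smul c (F_chi smul \<Phi> chi x v)"
  proof (cases "Atw_odd x")
    case True
    then obtain h where "x = GG h" by (cases x) auto
    then show ?thesis by (simp only: F_chi_GG[OF assms] mode_sum_scale[OF G])
  next
    case False
    then obtain d where "\<forall>v. F_chi smul \<Phi> chi x v = smul d v" using F_chi_even by blast
    then show ?thesis by (simp only: scale_scale mult.commute)
  qed
qed

text \<open>Both sides are scalars: the left one is minus a pairing, and the parity of
  \<open>h + k\<close> decides whether S and C or T occur on the right.\<close>

lemma F_chi_bracket_GG:
  assumes "\<forall>k>p. chi_coeff chi k = 0" "p \<ge> 0"
  shows "F_chi smul \<Phi> chi (GG h) (F_chi smul \<Phi> chi (GG k) v) + F_chi smul \<Phi> chi (GG k) (F_chi smul \<Phi> chi (GG h) v)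
    = (\<Sum>z\<in>Poly_Mapping.keys (Atw_bracket (GG h) (GG k)).
         smul (Poly_Mapping.lookup (Atw_bracket (GG h) (GG k)) z) (F_chi smul \<Phi> chi z v))"
    (is "?L = ?R")
proof -
  note G = vanishes_below_G_coeff[OF assms]
  define e where "e = (-1 :: complex) powi h"
  have e1: "(-1 :: complex) powi (h + 1) = - e" by (simp add: e_def power_int_add_1)
  have L: "?L = smul (- pairing (G_coeff chi h) (G_coeff chi k)) v"
    unfolding F_chi_GG[OF assms] by (rule mode_sum_anticommutator[OF G G])
  show ?thesis
  proof (cases "even (h + k)")
    case True
    define n where "n = (h + k) div 2"
    have n: "2 * n = h + k" using True by (simp add: n_def)
    have ek: "(-1 :: complex) powi k = e" using True by (auto simp: e_def power_int_minus_left)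
    define r where "r = (of_int h / 2 :: complex)"
    define s where "s = (of_int k / 2 :: complex)"
    define \<beta> where "\<beta> = - e * (1/3) * (r\<^sup>2 - 1/4) * (if h + k = 0 then 1 else 0)"
    have B: "Atw_bracket (GG h) (GG k) = Poly_Mapping.single (SS n) (- e * 2) + Poly_Mapping.single CC \<beta>"
      using True by (simp add: Let_def e1 n_def \<beta>_def r_def)
    define c where "c = 1/2 * (chi_conv chi (2 * n) - (of_int n + 1) * chi_coeff chi (2 * n))"
    have "?R = smul (- e * 2) (F_chi smul \<Phi> chi (SS n) v) + smul \<beta> (F_chi smul \<Phi> chi CC v)"
      unfolding B by (rule sum_keys_single_plus_single[of "SS n" CC "\<lambda>c z. smul c (F_chi smul \<Phi> chi z v)"])
        simp_all
    also have "F_chi smul \<Phi> chi (SS n) v = smul c v"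
      by (simp add: c_def chi_conv_def)
    finally have R: "?R = smul (- e * 2 * c + \<beta> * - 3) v"
      by (simp only: F_chi.simps scale_scale scale_left_distrib)
    have rs: "of_int n = r + s"
      using arg_cong[OF n, of "of_int :: int \<Rightarrow> complex"] by (simp add: r_def s_def field_simps)
    \<comment> \<open>For \<open>s = - r\<close> the product of the two derivative terms is (r +
      1/2)(1/2 - r) = 1/4 - r^2; it matches the central term because C acts as
      \<open>-3\<close>.\<close>
    have "- pairing (G_coeff chi h) (G_coeff chi k) = - e * 2 * c + \<beta> * - 3"
    proof (cases "h + k = 0")
      case True
      then have "k = - h" by simp
      then have s: "s = - r" by (simp add: r_def s_def)
      show ?thesis
        unfolding pairing_G_coeff[OF assms] c_def \<beta>_def ek n rs
          e_def[symmetric] r_def[symmetric] s_def[symmetric] s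
        using True by (simp add: add.commute[of k h] algebra_simps power2_eq_square)
    next
      case False
      then show ?thesis
        unfolding pairing_G_coeff[OF assms] c_def \<beta>_def ek n rs
          e_def[symmetric] r_def[symmetric] s_def[symmetric]
        by (simp add: add.commute[of k h] algebra_simps)
    qed
    then show ?thesis unfolding L R by simp
  next
    case False
    define n where "n = (h + k - 1) div 2"
    have n: "2 * n + 1 = h + k" using False by (simp add: n_def)
    have ek: "(-1 :: complex) powi k = - e" using False by (auto simp: e_def power_int_minus_left)
    define \<beta> where "\<beta> = - e * - (of_int h / 2 - of_int k / 2)"
    have B: "Atw_bracket (GG h) (GG k) = Poly_Mapping.single (TT n) \<beta>"
      using False by (simp add: Let_def e1 n_def \<beta>_def)
    have "?R = smul \<beta> (F_chi smul \<Phi> chi (TT n) v)"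
      unfolding B by (rule sum_keys_single[of "\<lambda>c z. smul c (F_chi smul \<Phi> chi z v)"]) simp
    then have R: "?R = smul (\<beta> * chi_coeff chi (h + k)) v"
      by (simp add: n)
    have hk: "h + k \<noteq> 0" "k + h \<noteq> 0" using n by presburger+
    have "- pairing (G_coeff chi h) (G_coeff chi k) = \<beta> * chi_coeff chi (h + k)"
      unfolding pairing_G_coeff[OF assms] \<beta>_def ek e_def[symmetric]
      using chi_conv_odd[OF assms(1), of "k + h"] False hk
      by (simp add: add.commute[of k h] algebra_simps)
    then show ?thesis unfolding L R by simp
  qed
qed

lemma Atw_module_F_chi:
  assumes "\<forall>k>p. chi_coeff chi k = 0" "p \<ge> 0"
  shows "Atw_module smul (F_chi smul \<Phi> chi)"
  unfolding Atw_module_def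
proof (intro conjI allI)
  let ?\<rho> = "F_chi smul \<Phi> chi"
  show "vector_space smul" by (rule vector_space_axioms)
  show "Vector_Spaces.linear smul smul (?\<rho> x)" for x
    unfolding Vector_Spaces.linear_def module_hom_def module_hom_axioms_def
    by (intro conjI allI vector_space_axioms module_axioms F_chi_linear[OF assms])
  fix x y v
  show "(if Atw_odd x \<and> Atw_odd y then ?\<rho> x (?\<rho> y v) + ?\<rho> y (?\<rho> x v) else ?\<rho> x (?\<rho> y v) - ?\<rho> y (?\<rho> x v))
    = (\<Sum>z\<in>Poly_Mapping.keys (Atw_bracket x y). smul (Poly_Mapping.lookup (Atw_bracket x y) z) (?\<rho> z v))"
  proof (cases "Atw_odd x \<and> Atw_odd y")
    case True
    then obtain h k where "x = GG h" "y = GG k" by (cases x; cases y) auto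
    then show ?thesis using F_chi_bracket_GG[OF assms, of h k v] by (simp only: Atw_odd.simps if_True simp_thms)
  next
    case False
    then have B: "Atw_bracket x y = 0" by (cases x; cases y) auto
    have "?\<rho> x (?\<rho> y v) = ?\<rho> y (?\<rho> x v)"
    proof (cases "Atw_odd x")
      case True
      then obtain c where "\<forall>v. ?\<rho> y v = smul c v" using False F_chi_even[of y] by blast
      then show ?thesis by (simp only: F_chi_linear(2)[OF assms])
    next
      case False
      then obtain c where "\<forall>v. ?\<rho> x v = smul c v" using F_chi_even[of x] by blast
      then show ?thesis by (simp only: F_chi_linear(2)[OF assms])
    qed
    then show ?thesis unfolding if_not_P[OF False] B by simp
  qed
qed

text \<open>The even generators act by scalars, so only the G(r) constrain a subspace.\<close>

lemma irreducible_F_chi_iff: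
  assumes "\<forall>k>p. chi_coeff chi k = 0" "p \<ge> 0"
  shows "irreducible_Atw_module smul (F_chi smul \<Phi> chi) \<longleftrightarrow>
    (\<forall>U. subspace U \<and> (\<forall>h. \<forall>u\<in>U. mode_sum (G_coeff chi h) u \<in> U) \<longrightarrow> U = {0} \<or> U = UNIV)"
proof -
  have "(\<forall>x. \<forall>u\<in>U. F_chi smul \<Phi> chi x u \<in> U) \<longleftrightarrow> (\<forall>h. \<forall>u\<in>U. mode_sum (G_coeff chi h) u \<in> U)"
    if U: "subspace U" for U
  proof
    assume "\<forall>x. \<forall>u\<in>U. F_chi smul \<Phi> chi x u \<in> U"
    then show "\<forall>h. \<forall>u\<in>U. mode_sum (G_coeff chi h) u \<in> U"
      unfolding F_chi_GG[OF assms, symmetric] by (intro allI) (erule spec)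
  next
    assume G: "\<forall>h. \<forall>u\<in>U. mode_sum (G_coeff chi h) u \<in> U"
    show "\<forall>x. \<forall>u\<in>U. F_chi smul \<Phi> chi x u \<in> U"
    proof (intro allI ballI)
      fix x u assume u: "u \<in> U"
      show "F_chi smul \<Phi> chi x u \<in> U"
      proof (cases "Atw_odd x")
        case True
        then obtain h where x: "x = GG h" by (cases x) auto
        show ?thesis unfolding x F_chi_GG[OF assms] using G u by blast
      next
        case False
        then obtain c where "F_chi smul \<Phi> chi x u = smul c u" using F_chi_even by blast
        then show ?thesis using subspace_scale[OF U u] by simp
      qed
    qed
  qed
  moreover have "\<exists>v :: 'v. v \<noteq> 0" using vac_nonzero by blast
  ultimately show ?thesis
    using Atw_module_F_chi[OF assms]
    unfolding irreducible_Atw_module_def irreducible_action_def by (simp cong: conj_cong)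
qed

text \<open>Supplies the elimination step with a rescaled \<open>G_coeff chi h\<close>, or with the
  zero family when \<open>x a = 0\<close>.\<close>

lemma G_invariant_mode_sum:
  assumes U: "subspace U" "\<forall>h. \<forall>u\<in>U. mode_sum (G_coeff chi h) u \<in> U"
    and xi: "vanishes_below b xi"
    and lead: "\<And>a x. vanishes_below a x \<Longrightarrow> pairing x xi = 0 \<Longrightarrow> x a \<noteq> 0 \<Longrightarrow>
      \<exists>h. vanishes_below a (G_coeff chi h) \<and> G_coeff chi h a \<noteq> 0 \<and> pairing (G_coeff chi h) xi = 0"
    and x: "vanishes_below a x" "pairing x xi = 0" and u: "u \<in> U"
  shows "mode_sum x u \<in> U"
proof (rule mode_sum_invariant[OF U(1) u xi _ x])
  fix a x assume x: "vanishes_below a x" "pairing x xi = 0"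
  show "\<exists>y. vanishes_below a y \<and> pairing y xi = 0 \<and> (\<forall>u\<in>U. mode_sum y u \<in> U) \<and> y a = x a"
  proof (cases "x a = 0")
    case True
    have z: "vanishes_below a (\<lambda>_. 0)" by (simp add: vanishes_below_def)
    have "pairing (\<lambda>_. 0) xi = 0" by (simp add: pairing_def)
    moreover have "mode_sum (\<lambda>_. 0) u \<in> U" for u
      using subspace_0[OF U(1)] by (simp add: mode_sum_def)
    ultimately show ?thesis using z True by (intro exI[of _ "\<lambda>_. 0"]) simp
  next
    case False
    then obtain h where h: "vanishes_below a (G_coeff chi h)" "G_coeff chi h a \<noteq> 0" "pairing (G_coeff chi h) xi = 0"
      using lead[OF x] by blast
    let ?c = "x a / G_coeff chi h a"
    let ?y = "\<lambda>m. ?c * G_coeff chi h m"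
    have "vanishes_below a ?y" using h(1) by (simp add: vanishes_below_def)
    moreover have "pairing ?y xi = 0"
    proof -
      have z: "vanishes_below a (\<lambda>_. 0)" by (simp add: vanishes_below_def)
      have "pairing (\<lambda>_. 0) xi = 0" by (simp add: pairing_def)
      then show ?thesis using pairing_linear_left[OF z h(1) xi, of ?c] h(3) by simp
    qed
    moreover have "\<forall>u\<in>U. mode_sum ?y u \<in> U"
      unfolding mode_sum_cmult[OF h(1)] using U subspace_scale by blast
    moreover have "?y a = x a" using h(2) by simp
    ultimately show ?thesis by blast
  qed
qed

text \<open>Taking \<open>xi = 0\<close> makes the orthogonality condition void, so elimination
  recovers each single mode \<open>delta j\<close>.\<close>

lemma irreducible_if_leading_coeffs_nonzero:
  assumes "\<forall>k>p. chi_coeff chi k = 0" "p \<ge> 0"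
    and lead: "\<And>a. \<exists>h. vanishes_below a (G_coeff chi h) \<and> G_coeff chi h a \<noteq> 0"
  shows "irreducible_Atw_module smul (F_chi smul \<Phi> chi)"
  unfolding irreducible_F_chi_iff[OF assms(1,2)]
proof (intro allI impI, elim conjE)
  fix U assume U: "subspace U" "\<forall>h. \<forall>u\<in>U. mode_sum (G_coeff chi h) u \<in> U"
  have z: "vanishes_below 0 (\<lambda>_. 0)" by (simp add: vanishes_below_def)
  have p0: "pairing x (\<lambda>_. 0) = 0" for x by (simp add: pairing_def)
  show "U = {0} \<or> U = UNIV"
  proof (rule irreducible[OF U(1)])
    fix j u assume u: "u \<in> U"
    have "mode_sum (delta j) u \<in> U"
      by (rule G_invariant_mode_sum[OF U z _ vanishes_below_delta p0 u]) (use lead p0 in simp)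
    then show "\<Phi> j u \<in> U" by (simp add: mode_sum_delta)
  qed
qed

text \<open>The leading coefficient of G(h/2) is (L - h)/2 and fails only at \<open>h = L\<close>;
  orthogonality to the null mode excludes exactly this leading index. The two signs of the criterion
  are the isotropic and the anisotropic case.\<close>

lemma irreducible_iff_null_mode_anisotropic:
  assumes expansion: "\<forall>k>0. chi_coeff chi k = 0"
    and chi0: "chi_coeff chi 0 = (of_int L + 1) / 2"
    and g0: "g $ 0 = 1" and g: "fps_X * fps_deriv g = - 2 * chi_fps chi * g"
  shows "irreducible_Atw_module smul (F_chi smul \<Phi> chi) \<longleftrightarrow> pairing (null_mode L g) (null_mode L g) \<noteq> 0"
proof -
  let ?xi = "null_mode L g"
  note xi = vanishes_below_null_mode[of L g]
  have G: "vanishes_below h (G_coeff chi h)" for h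
    using vanishes_below_G_coeff[OF expansion, of h] by simp
  have Gxi: "pairing (G_coeff chi h) ?xi = 0" for h
    by (rule pairing_G_coeff_null_mode[OF expansion chi0 g])
  have xiL: "?xi (- L) \<noteq> 0" by (simp add: null_mode_def g0)
  have lead: "\<exists>h. vanishes_below a (G_coeff chi h) \<and> G_coeff chi h a \<noteq> 0 \<and> pairing (G_coeff chi h) ?xi = 0"
    if x: "vanishes_below a x" "pairing x ?xi = 0" "x a \<noteq> 0" for a x
  proof -
    \<comment> \<open>For \<open>x\<close> starting at \<open>L\<close>, the pairing with the null
      mode, which starts at \<open>- L\<close>, is the single term \<open>x L\<close> times a
      nonzero number.\<close>
    have "a \<noteq> L"
    proof
      assume a: "a = L"
      have "pairing x ?xi = (\<Sum>m=-L..-L. (-1) powi m * x (- m) * ?xi m)"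
        by (rule pairing_eq_sum[OF x(1) xi]) (simp_all add: a)
      then show False using x(2,3) xiL a by simp
    qed
    then have "G_coeff chi a a \<noteq> 0"
      unfolding G_coeff_diag chi0 by (simp flip: of_int_add)
    then show ?thesis using G Gxi by blast
  qed
  show ?thesis
    unfolding irreducible_F_chi_iff[OF expansion order.refl]
  proof
    assume irr: "\<forall>U. subspace U \<and> (\<forall>h. \<forall>u\<in>U. mode_sum (G_coeff chi h) u \<in> U) \<longrightarrow> U = {0} \<or> U = UNIV"
    show "pairing ?xi ?xi \<noteq> 0"
    proof
      assume "pairing ?xi ?xi = 0"
      note K = isotropic_kernel[OF xi xiL this]
      have "\<forall>h. \<forall>u\<in>{v. mode_sum ?xi v = 0}. mode_sum (G_coeff chi h) u \<in> {v. mode_sum ?xi v = 0}"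
        by (intro allI ballI) (rule K(4)[OF G Gxi])
      then show False using irr K(1-3) by blast
    qed
  next
    assume ne: "pairing ?xi ?xi \<noteq> 0"
    show "\<forall>U. subspace U \<and> (\<forall>h. \<forall>u\<in>U. mode_sum (G_coeff chi h) u \<in> U) \<longrightarrow> U = {0} \<or> U = UNIV"
    proof (intro allI impI, elim conjE)
      fix U assume U: "subspace U" "\<forall>h. \<forall>u\<in>U. mode_sum (G_coeff chi h) u \<in> U"
      show "U = {0} \<or> U = UNIV"
      proof (rule anisotropic_irreducible[OF xi ne U(1)])
        fix a x u assume *: "vanishes_below a x" "pairing x ?xi = 0" "u \<in> U"
        show "mode_sum x u \<in> U"
          by (rule G_invariant_mode_sum[OF U xi _ *]) (rule lead)
      qed
    qed
  qed
qed

end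

section \<open>Case distinction and comparison with the determinant\<close>

theorem theorem1p2:
  fixes smul :: "complex \<Rightarrow> 'v \<Rightarrow> 'v::ab_group_add"
    and \<Phi> :: "int \<Rightarrow> 'v \<Rightarrow> 'v"
    and vac :: 'v
    and i :: nat
    and twop :: nat \<comment> \<open>\<open>twop = 2p\<close>\<close>
    and chi :: "complex fls"
  assumes i: "i \<in> {1, 2}"
    and F: "is_F_T i smul \<Phi> vac"
    and expansion: "\<forall>h > int twop. chi_coeff chi h = 0"
    and order: "twop > 0 \<longrightarrow> chi_coeff chi (int twop) \<noteq> 0"
  shows "irreducible_Atw_module smul (F_chi smul \<Phi> chi) \<longleftrightarrow>
      (twop > 0 \<and> chi_coeff chi (int twop) \<noteq> 0)
    \<or> (twop = 0 \<and> chi_coeff chi 0 \<in> (UNIV - {of_int m / 2 | m. True}) \<union> {1/2})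
    \<or> (twop = 0 \<and> (\<exists>L::nat. chi_coeff chi 0 - 1/2 = of_nat L / 2 \<and> Determinant.det (A_matrix chi L) \<noteq> 0))"
proof -
  interpret twisted_fock i smul \<Phi> vac by (unfold_locales) (rule F)
  show ?thesis
  proof (cases "twop > 0")
    case True
    have "irreducible_Atw_module smul (F_chi smul \<Phi> chi)"
    proof (rule irreducible_if_leading_coeffs_nonzero[OF expansion])
      fix a
      have "vanishes_below a (G_coeff chi (a + int twop))"
        using vanishes_below_G_coeff[OF expansion, of "a + int twop"] by simp
      \<comment> \<open>The derivative term sits at index \<open>a + twop\<close>, above the leading
        index \<open>a\<close>, so the leading coefficient is \<chi>_p alone.\<close>
      moreover have "G_coeff chi (a + int twop) a \<noteq> 0"
        using order True by (simp add: G_coeff_def delta_def)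
      ultimately show "\<exists>h. vanishes_below a (G_coeff chi h) \<and> G_coeff chi h a \<noteq> 0" by blast
    qed simp
    then show ?thesis using True order by blast
  next
    case False
    then have twop: "twop = 0" by simp
    have exp: "\<forall>k>0. chi_coeff chi k = 0" using expansion twop by simp
    show ?thesis
    proof (cases "chi_coeff chi 0 \<in> {of_int m / 2 | m. True}")
      case False
      have "irreducible_Atw_module smul (F_chi smul \<Phi> chi)"
      proof (rule irreducible_if_leading_coeffs_nonzero[OF exp order.refl])
        fix a
        have "vanishes_below a (G_coeff chi a)"
          using vanishes_below_G_coeff[OF exp, of a] by simp
        moreover have "G_coeff chi a a \<noteq> 0"
        proof
          assume "G_coeff chi a a = 0"
          then have "chi_coeff chi 0 = of_int (a + 1) / 2" by (simp add: G_coeff_diag)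
          then show False using False by blast
        qed
        ultimately show "\<exists>h. vanishes_below a (G_coeff chi h) \<and> G_coeff chi h a \<noteq> 0" by blast
      qed
      then show ?thesis using False twop by blast
    next
      case True
      then obtain m where m: "chi_coeff chi 0 = of_int m / 2" by blast
      \<comment> \<open>Chosen so that \<chi>_0 - 1/2 = L/2; \<open>L\<close> may be
        negative.\<close>
      define L where "L = m - 1"
      have chi0: "chi_coeff chi 0 = (of_int L + 1) / 2" by (simp add: m L_def)
      \<comment> \<open>\<open>g\<close> is a series in z^(1/2) built from all of \<chi>, whereas
        \<open>f\<close> is a series in z built from \<chi>^(1).\<close>
      obtain g where g: "g $ 0 = 1" "fps_X * fps_deriv g = - 2 * chi_fps chi * g"
        using theta_solution_exists[of "- 2 * chi_fps chi"] by (auto simp: chi_fps_def)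
      obtain f where f: "f $ 0 = 1" "fps_X * fps_deriv f = - chi_even chi * f"
        using theta_solution_exists[of "- chi_even chi"] by (auto simp: chi_even_def)
      have "(g * (g oo - fps_X)) $ (2 * n) = (f * f) $ n" for n
        by (rule even_part_integrating_factor[OF _ _ f g]) (simp_all add: chi_fps_def chi_even_def)
      \<comment> \<open>For negative \<open>L\<close> the null mode is isotropic, which accounts for
        the condition \<open>L \<ge> 0\<close>.\<close>
      then have irr: "irreducible_Atw_module smul (F_chi smul \<Phi> chi) \<longleftrightarrow> L \<ge> 0 \<and> (f * f) $ nat L \<noteq> 0"
        unfolding irreducible_iff_null_mode_anisotropic[OF exp chi0 g] pairing_null_mode_self by simp
      \<comment> \<open>At \<open>L = 0\<close>, that is \<chi>_0 = 1/2, the empty matrix has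
        determinant \<open>1\<close>, in agreement with \<open>(f * f) $ 0 = 1\<close>.\<close>
      have det: "det (A_matrix chi (nat L)) = 0 \<longleftrightarrow> (f * f) $ nat L = 0" if "L \<ge> 0"
      proof (cases "L = 0")
        case True
        have "det (A_matrix chi 0) = 1" by (rule det_dim_zero) (simp add: A_matrix_def)
        then show ?thesis using True f(1) by simp
      next
        case False
        then show ?thesis
          using that chi0 by (intro det_A_matrix_eq_0_iff[OF exp _ _ f]) simp_all
      qed
      have half: "chi_coeff chi 0 = 1/2 \<longleftrightarrow> L = 0"
        unfolding chi0 by (simp add: field_simps)
      have nat: "chi_coeff chi 0 - 1/2 = of_nat l / 2 \<longleftrightarrow> L = int l" for l
      proof -
        have "chi_coeff chi 0 - 1/2 = of_nat l / 2 \<longleftrightarrow> (of_int L :: complex) = of_int (int l)"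
          unfolding chi0 by (simp add: field_simps)
        then show ?thesis by (simp only: of_int_eq_iff)
      qed
      have "(\<exists>l::nat. chi_coeff chi 0 - 1/2 = of_nat l / 2 \<and> det (A_matrix chi l) \<noteq> 0)
          \<longleftrightarrow> L \<ge> 0 \<and> (f * f) $ nat L \<noteq> 0"
        unfolding nat using det by (metis nat_0_le nat_int of_nat_0_le_iff)
      moreover have "chi_coeff chi 0 = 1/2 \<Longrightarrow> L \<ge> 0 \<and> (f * f) $ nat L \<noteq> 0"
        using half f(1) by simp
      ultimately show ?thesis using irr True twop by blast
    qed
  qed
qed

end
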